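(* Suppose that (A1) for all $b,b'\in\mathcal B$, $\phi(b,t)-\phi(b',t)$ is single-crossing in $t$ and $v(b,t)-v(b',t)$ is monotonic in $t$; and (A2) for all $a,a'\in\Delta(\mathcal B)$, $\phi(a,t)-\phi(a',t)$ is single-crossing in $t$. Then the output of the elimination algorithm (described in the context) is the minimal optimal menu for the monopolist's problem.
   Context: Setup. There are $n\ge 1$ goods; $\mathcal B=2^{\{1,\dots,n\}}$ is the set of (deterministic) bundles and $\Delta(\mathcal B)$ is the set of probability distributions on $\mathcal B$ (stochastic bundles); a bundle $b$ is identified with the point mass at $b$. Types $t$ lie in $T=[\underline t,\bar t]\subseteq\mathbb R$, $\underline t<\bar t$, and are distributed according to $F$ with a continuous, positive density $f$. The value function $v:\Delta(\mathcal B)\times T\to\mathbb R$ is continuously differentiable in $t$, with $v(\emptyset,t)=0$ for all $t$ and $v(a,t)=\mathbb E_{b\sim a}[v(b,t)]$. The virtual value function is $\phi(b,t)=v(b,t)-\frac{1-F(t)}{f(t)}v_t(b,t)$, $v_t=\partial v/\partial t$, extended by $\phi(a,t)=\mathbb E_{b\sim a}[\phi(b,t)]$ for $a\in\Delta(\mathcal B)$. Standing assumptions: for $b\ne b'$ in $\mathcal B$ there is $t\in T$ with $\phi(b,t)\neq\phi(b',t)$; and $\max_{b\neq\emptyset}\phi(b,\underline t)<0=\phi(\emptyset,\underline t)$. Terminology. A function $g:T\to\mathbb R$ is single-crossing in $t$ if $\operatorname{sign}[g(t)]\in\{-1,0,1\}$ is a monotonic function of $t$ (either weakly increasing or weakly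 decreasing). "Monotonic" means weakly increasing or weakly decreasing on $T$. Monopolist's problem. A mechanism is a measurable map $(a,p):T\to\Delta(\mathcal B)\times\mathbb R$. It is IC if $v(a(t),t)-p(t)\ge v(a(t'),t)-p(t')$ for all $t,t'\in T$, and IR if $v(a(t),t)-p(t)\ge 0$ for all $t\in T$. The monopolist maximizes $\mathbb E[p(t)]$ over IC and IR mechanisms. A menu $B\subseteq\mathcal B$ is optimal if there is an optimal mechanism $(a,p)$ with $a(t)\in B$ for all $t$; an optimal menu $B$ is a minimal optimal menu if no $B'\subsetneq B$ is optimal. (Under (A1) and (A2) the minimal optimal menu is unique.) Elimination algorithm. Input: $\mathcal B$ and the values $\phi(\cdot,\underline t)$, $\phi(\cdot,\bar t)$. Step 1: remove from $\mathcal B$ every $b$ for which there exists $b'\ne b$ in $\mathcal B$ with $\phi(b',\bar t)\ge\phi(b,\bar t)$ and $\phi(b',\underline t)\ge\phi(b,\underline t)$. Step 2: list the remaining bundles as $b'_1,\dots,b'_l$ with $\phi(b'_1,\underline t)>\dots>\phi(b'_l,\underline t)$ and $\phi(b'_1,\bar t)<\dots<\phi(b'_l,\bar t)$. For each $i=2,\dots,l-1$, remove $b'_i$ if $$\frac{\phi(b'_{i+1},\bar t)-\phi(b'_i,\bar t)}{\phi(b'_i,\bar t)-\phi(b'_{i-1},\bar t)}\ \ge\ \frac{\phi(b'_{i+1},\underline t)-\phi(b'_i,\underline t)}{\phi(b'_i,\underline t)-\phi(b'_{i-1},\underline t)}.$$ Repeat Step 2 (relabeling the remaining bundles each time) until no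 bundle is removed during Step 2. Output: the set of remaining bundles. *)

theory Defs
  imports "HOL-Probability.Probability"
begin

text \<open>
  The goods are the elements of a finite type \<open>'g\<close> (there are \<open>CARD('g) \<ge> 1\<close> of them), so that
  \<open>'g set\<close> is the set of all bundles and \<open>'g set pmf\<close> the set of all stochastic bundles; the point
  mass at a bundle \<open>b\<close> is \<open>return_pmf b\<close>. The type space is \<open>{t0..t1}\<close>. Functions of the type
  are total on the reals, and only their values on \<open>{t0..t1}\<close> are ever used.
\<close>


section \<open>Functions of the type\<close>

definition monotonic_on :: "real set \<Rightarrow> (real \<Rightarrow> real) \<Rightarrow> bool" where
  "monotonic_on T g \<longleftrightarrow> mono_on T g \<or> antimono_on T g"

definition single_crossing_on :: "real set \<Rightarrow> (real \<Rightarrow> real) \<Rightarrow> bool" where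
  "single_crossing_on T g \<longleftrightarrow> monotonic_on T (\<lambda>t. sgn (g t))"

text \<open>The derivative is taken within \<open>T\<close>, hence one-sided at the end points of an interval.\<close>

definition continuously_differentiable_on :: "real set \<Rightarrow> (real \<Rightarrow> real) \<Rightarrow> bool" where
  "continuously_differentiable_on T g \<longleftrightarrow>
     (\<exists>g'. (\<forall>t\<in>T. (g has_vector_derivative g' t) (at t within T)) \<and> continuous_on T g')"


section \<open>Type distribution and virtual values\<close>

definition type_distr :: "real \<Rightarrow> real \<Rightarrow> (real \<Rightarrow> real) \<Rightarrow> real measure" where
  "type_distr t0 t1 f = density lborel (\<lambda>t. ennreal (indicator {t0..t1} t * f t))"

definition virtual_value_bundle ::
  "real \<Rightarrow> real \<Rightarrow> (real \<Rightarrow> real) \<Rightarrow> ('g::finite set pmf \<Rightarrow> real \<Rightarrow> real) \<Rightarrow> 'g set \<Rightarrow> real \<Rightarrow> real"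
  where
  "virtual_value_bundle t0 t1 f v b t =
     v (return_pmf b) t
       - (1 - cdf (type_distr t0 t1 f) t) / f t
         * vector_derivative (v (return_pmf b)) (at t within {t0..t1})"

definition virtual_value ::
  "real \<Rightarrow> real \<Rightarrow> (real \<Rightarrow> real) \<Rightarrow> ('g::finite set pmf \<Rightarrow> real \<Rightarrow> real) \<Rightarrow> 'g set pmf \<Rightarrow> real \<Rightarrow> real"
  where
  "virtual_value t0 t1 f v a t =
     measure_pmf.expectation a (\<lambda>b. virtual_value_bundle t0 t1 f v b t)"


section \<open>The monopolist's problem\<close>

text \<open>
  The stochastic bundles carry the \<open>\<sigma>\<close>-algebra generated by the evaluations at events, which on a
  finite set of bundles is the Borel \<open>\<sigma>\<close>-algebra of the probability simplex.
\<close>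

definition mechanism ::
  "real \<Rightarrow> real \<Rightarrow> (real \<Rightarrow> 'g::finite set pmf) \<Rightarrow> (real \<Rightarrow> real) \<Rightarrow> bool" where
  "mechanism t0 t1 a p \<longleftrightarrow>
     (\<lambda>t. (measure_pmf (a t), p t))
       \<in> restrict_space borel {t0..t1} \<rightarrow>\<^sub>M prob_algebra (count_space UNIV) \<Otimes>\<^sub>M borel"

definition IC ::
  "real \<Rightarrow> real \<Rightarrow> ('g::finite set pmf \<Rightarrow> real \<Rightarrow> real) \<Rightarrow>
   (real \<Rightarrow> 'g set pmf) \<Rightarrow> (real \<Rightarrow> real) \<Rightarrow> bool" where
  "IC t0 t1 v a p \<longleftrightarrow>
     (\<forall>t\<in>{t0..t1}. \<forall>t'\<in>{t0..t1}. v (a t) t - p t \<ge> v (a t') t - p t')"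

definition IR ::
  "real \<Rightarrow> real \<Rightarrow> ('g::finite set pmf \<Rightarrow> real \<Rightarrow> real) \<Rightarrow>
   (real \<Rightarrow> 'g set pmf) \<Rightarrow> (real \<Rightarrow> real) \<Rightarrow> bool" where
  "IR t0 t1 v a p \<longleftrightarrow> (\<forall>t\<in>{t0..t1}. v (a t) t - p t \<ge> 0)"

definition feasible ::
  "real \<Rightarrow> real \<Rightarrow> ('g::finite set pmf \<Rightarrow> real \<Rightarrow> real) \<Rightarrow>
   (real \<Rightarrow> 'g set pmf) \<Rightarrow> (real \<Rightarrow> real) \<Rightarrow> bool" where
  "feasible t0 t1 v a p \<longleftrightarrow> mechanism t0 t1 a p \<and> IC t0 t1 v a p \<and> IR t0 t1 v a p"

text \<open>
  The expectation is restricted to \<open>{t0..t1}\<close>, which has probability one, because a mechanism is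
  measurable only there.
\<close>

definition revenue :: "real \<Rightarrow> real \<Rightarrow> (real \<Rightarrow> real) \<Rightarrow> (real \<Rightarrow> real) \<Rightarrow> real" where
  "revenue t0 t1 f p = (LINT t:{t0..t1}|type_distr t0 t1 f. p t)"

definition optimal_mechanism ::
  "real \<Rightarrow> real \<Rightarrow> (real \<Rightarrow> real) \<Rightarrow> ('g::finite set pmf \<Rightarrow> real \<Rightarrow> real) \<Rightarrow>
   (real \<Rightarrow> 'g set pmf) \<Rightarrow> (real \<Rightarrow> real) \<Rightarrow> bool" where
  "optimal_mechanism t0 t1 f v a p \<longleftrightarrow>
     feasible t0 t1 v a p \<and>
     (\<forall>a' p'. feasible t0 t1 v a' p' \<longrightarrow> revenue t0 t1 f p' \<le> revenue t0 t1 f p)"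

definition optimal_menu ::
  "real \<Rightarrow> real \<Rightarrow> (real \<Rightarrow> real) \<Rightarrow> ('g::finite set pmf \<Rightarrow> real \<Rightarrow> real) \<Rightarrow> 'g set set \<Rightarrow> bool" where
  "optimal_menu t0 t1 f v B \<longleftrightarrow>
     (\<exists>a p. optimal_mechanism t0 t1 f v a p \<and> (\<forall>t\<in>{t0..t1}. a t \<in> return_pmf ` B))"

definition minimal_optimal_menu ::
  "real \<Rightarrow> real \<Rightarrow> (real \<Rightarrow> real) \<Rightarrow> ('g::finite set pmf \<Rightarrow> real \<Rightarrow> real) \<Rightarrow> 'g set set \<Rightarrow> bool" where
  "minimal_optimal_menu t0 t1 f v B \<longleftrightarrow>
     optimal_menu t0 t1 f v B \<and> (\<forall>B'. B' \<subset> B \<longrightarrow> \<not> optimal_menu t0 t1 f v B')"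


section \<open>The elimination algorithm\<close>

text \<open>
  Here \<open>x b\<close> and \<open>y b\<close> stand for the virtual values of \<open>b\<close> at the lowest and at the highest type.
\<close>

definition elim_step1 :: "('b \<Rightarrow> real) \<Rightarrow> ('b \<Rightarrow> real) \<Rightarrow> 'b set \<Rightarrow> 'b set" where
  "elim_step1 x y S = {b \<in> S. \<not> (\<exists>b'\<in>S. b' \<noteq> b \<and> y b' \<ge> y b \<and> x b' \<ge> x b)}"

text \<open>
  One pass of the second step: all removals of a pass refer to the list as it is at the
  beginning of the pass. Lists are indexed from 0.
\<close>

definition removable :: "('b \<Rightarrow> real) \<Rightarrow> ('b \<Rightarrow> real) \<Rightarrow> 'b list \<Rightarrow> nat \<Rightarrow> bool" where
  "removable x y bs i \<longleftrightarrow>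
     1 \<le> i \<and> i + 1 < length bs \<and>
     (y (bs ! (i + 1)) - y (bs ! i)) / (y (bs ! i) - y (bs ! (i - 1)))
       \<ge> (x (bs ! (i + 1)) - x (bs ! i)) / (x (bs ! i) - x (bs ! (i - 1)))"

definition elim_step2 :: "('b \<Rightarrow> real) \<Rightarrow> ('b \<Rightarrow> real) \<Rightarrow> 'b list \<Rightarrow> 'b list" where
  "elim_step2 x y bs = nths bs {i. \<not> removable x y bs i}"

function elim_loop :: "('b \<Rightarrow> real) \<Rightarrow> ('b \<Rightarrow> real) \<Rightarrow> 'b list \<Rightarrow> 'b list" where
  "elim_loop x y bs =
     (if \<exists>i<length bs. removable x y bs i then elim_loop x y (elim_step2 x y bs) else bs)"
  by pat_completeness auto

termination
proof (relation "Wellfounded.measure (\<lambda>(x, y, bs). length bs)")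
  fix x y :: "'b \<Rightarrow> real" and bs :: "'b list"
  assume "\<exists>i<length bs. removable x y bs i"
  then have "{i. i < length bs \<and> \<not> removable x y bs i} \<subset> {..<length bs}"
    by auto
  then have "card {i. i < length bs \<and> \<not> removable x y bs i} < card {..<length bs}"
    by (intro psubset_card_mono) auto
  then have "length (elim_step2 x y bs) < length bs"
    by (simp add: elim_step2_def length_nths)
  then show "((x, y, elim_step2 x y bs), (x, y, bs)) \<in> Wellfounded.measure (\<lambda>(x, y, bs). length bs)"
    by simp
qed simp

declare elim_loop.simps [simp del]

text \<open>
  The survivors of the first step have distinct values of \<open>x\<close>, so that they are listed by strictly
  decreasing \<open>x\<close>, and therefore by strictly increasing \<open>y\<close>.
\<close>

definition elimination_output :: "('b \<Rightarrow> real) \<Rightarrow> ('b \<Rightarrow> real) \<Rightarrow> 'b set \<Rightarrow> 'b set" where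
  "elimination_output x y S =
     set (elim_loop x y (sorted_key_list_of_set (\<lambda>b. - x b) (elim_step1 x y S)))"

lemma elim_step1_inj_on: "inj_on (\<lambda>b. - x b) (elim_step1 x y S)"
  by (intro inj_onI) (auto simp: elim_step1_def, metis linear)

lemma (in linorder) sorted_key_list_of_set_inj_on:
  assumes "inj_on k S" "finite S"
  shows "set (sorted_key_list_of_set k S) = S"
    and "sorted_wrt (<) (map k (sorted_key_list_of_set k S))"
proof -
  interpret folding_insort_key "(\<le>)" "(<)" S k
    by unfold_locales fact
  show "set (sorted_key_list_of_set k S) = S"
    using assms(2) by (rule set_sorted_key_list_of_set[OF subset_refl])
  show "sorted_wrt (<) (map k (sorted_key_list_of_set k S))"
    by (rule strict_sorted_key_list_of_set[OF subset_refl])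
qed

lemma elim_step1_listing:
  fixes x y :: "'b \<Rightarrow> real"
  assumes "finite S"
  defines "bs \<equiv> sorted_key_list_of_set (\<lambda>b. - x b) (elim_step1 x y S)"
  shows "set bs = elim_step1 x y S"
    and "sorted_wrt (\<lambda>b b'. x b > x b' \<and> y b < y b') bs"
proof -
  have fin: "finite (elim_step1 x y S)"
    using assms(1) by (simp add: elim_step1_def)
  note listing = sorted_key_list_of_set_inj_on[OF elim_step1_inj_on fin]
  show set_bs: "set bs = elim_step1 x y S"
    unfolding bs_def by (rule listing(1))
  have "sorted_wrt (\<lambda>b b'. x b > x b') bs"
    using listing(2) unfolding bs_def by (simp add: sorted_wrt_map)
  then show "sorted_wrt (\<lambda>b b'. x b > x b' \<and> y b < y b') bs"
  proof (rule sorted_wrt_mono_rel[rotated])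
    fix b b' assume "b \<in> set bs" "b' \<in> set bs" "x b > x b'"
    then show "x b > x b' \<and> y b < y b'"
      unfolding set_bs elim_step1_def by force
  qed
qed

end

theory Submission
  imports Defs
begin

text \<open>
  By the envelope formula, the revenue of an incentive compatible mechanism is its expected virtual
  surplus minus the utility of the lowest type, so that no mechanism earns more than the expected
  pointwise maximum of the virtual values. By (A2), a bundle that is dominated at both extreme types
  by another bundle or by a lottery over two others is dominated at every type; hence the
  elimination algorithm keeps a pointwise maximizer at every type. Along the surviving list the
  pointwise maximizer moves upwards with the type, and by (A1) so do the slopes of the
  values, which makes this selection incentive compatible, hence optimal. Conversely, each survivor
  is a strict vertex of the upper right hull of the points of virtual values at the two extreme
  types, and is therefore strictly best on an interval of types, so every optimal menu must
  contain it.
\<close>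

section \<open>Elimination and single-crossing families\<close>

text \<open>Plotting each bundle at the point formed by its virtual values at \<open>t0\<close> and
  \<open>t1\<close>, the algorithm computes an upper right hull. The only bridge from the two ends
  to the types in between is that all combinations of virtual values with coefficients of sum zero
  are single-crossing, so that a common sign at both ends holds throughout. The main obstacle is
  ties: a single-crossing difference may vanish on a whole interval of types, Step 2 removes points
  lying exactly on a chord, and one pass may remove adjacent bundles at once. Hence the first and
  the last maximizer in the list are followed through a pass, the optimal selection takes the first
  one, and strictness is sought beyond the last zero of a difference. The other obstacle is that
  competing mechanisms are merely measurable and choose a different lottery for each type; all
  estimates on values are therefore uniform in the lottery and in the type.\<close>

lemma single_crossing_on_cases:
  assumes "single_crossing_on T g"
  obtains "\<And>s t. s \<in> T \<Longrightarrow> t \<in> T \<Longrightarrow> s \<le> t \<Longrightarrow> sgn (g s) \<le> sgn (g t)"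
  | "\<And>s t. s \<in> T \<Longrightarrow> t \<in> T \<Longrightarrow> s \<le> t \<Longrightarrow> sgn (g t) \<le> sgn (g s)"
  using assms by (auto simp: single_crossing_on_def monotonic_on_def monotone_on_def)

text \<open>A monotonic sign is, at any point of the interval, at least the smaller of the signs at
  the two ends.\<close>

lemma single_crossing_on_interval:
  assumes "single_crossing_on {t0..t1} g" "t \<in> {t0..t1}"
  shows "0 \<le> g t0 \<Longrightarrow> 0 \<le> g t1 \<Longrightarrow> 0 \<le> g t"
    and "0 < g t0 \<Longrightarrow> 0 < g t1 \<Longrightarrow> 0 < g t"
proof -
  have "sgn (g t0) \<le> sgn (g t) \<or> sgn (g t1) \<le> sgn (g t)"
    by (rule single_crossing_on_cases[OF assms(1)]) (use assms(2) in auto)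
  then show "0 \<le> g t0 \<Longrightarrow> 0 \<le> g t1 \<Longrightarrow> 0 \<le> g t" "0 < g t0 \<Longrightarrow> 0 < g t1 \<Longrightarrow> 0 < g t"
    by (auto simp: sgn_if split: if_splits)
qed

text \<open>Opposite signs at the ends rule out a decreasing sign, so a positive value stays
  positive further right.\<close>

lemma single_crossing_on_up:
  assumes "single_crossing_on {t0..t1} g" "s \<in> {t0..t1}" "t \<in> {t0..t1}" "s \<le> t"
    and "g t0 < 0" "0 < g t1" "0 < g s"
  shows "0 < g t"
proof (rule single_crossing_on_cases[OF assms(1)])
  assume "\<And>s t. s \<in> {t0..t1} \<Longrightarrow> t \<in> {t0..t1} \<Longrightarrow> s \<le> t \<Longrightarrow> sgn (g s) \<le> sgn (g t)"
  from this[OF assms(2-4)] assms(7) show ?thesis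
    by (auto simp: sgn_if split: if_splits)
next
  assume "\<And>s t. s \<in> {t0..t1} \<Longrightarrow> t \<in> {t0..t1} \<Longrightarrow> s \<le> t \<Longrightarrow> sgn (g t) \<le> sgn (g s)"
  from this[of t0 t1] assms show ?thesis
    by (auto simp: sgn_if split: if_splits)
qed

text \<open>Separates the combinatorics of the algorithm from the screening problem;
  \<open>e\<close> stands for the empty bundle. (A2) is put in linear form, over all coefficients of
  sum zero, because differences of lotteries can then be added and scaled freely.\<close>

locale sc_family =
  fixes t0 t1 :: real and \<phi> :: "'b::finite \<Rightarrow> real \<Rightarrow> real" and e :: 'b
  assumes t0_less_t1: "t0 < t1"
    and initially_best: "b \<noteq> e \<Longrightarrow> \<phi> b t0 < \<phi> e t0"
    and continuous: "continuous_on {t0..t1} (\<phi> b)"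
    and single_crossing: "(\<Sum>b\<in>UNIV. c b) = 0 \<Longrightarrow>
      single_crossing_on {t0..t1} (\<lambda>t. \<Sum>b\<in>UNIV. c b * \<phi> b t)"
    and distinct: "b \<noteq> b' \<Longrightarrow> \<exists>t\<in>{t0..t1}. \<phi> b t \<noteq> \<phi> b' t"
begin

section \<open>Zero-sum combinations and their signs at the two ends\<close>

definition contrasts :: "(real \<Rightarrow> real) set" where
  "contrasts = {g. \<exists>c. (\<Sum>b\<in>UNIV. c b) = 0 \<and> g = (\<lambda>t. \<Sum>b\<in>UNIV. c b * \<phi> b t)}"

lemma contrasts_diff: "(\<lambda>t. \<phi> b t - \<phi> b' t) \<in> contrasts"
  unfolding contrasts_def
  by (rule CollectI, rule exI[of _ "\<lambda>z. of_bool (z = b) - of_bool (z = b')"])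
     (auto simp: left_diff_distrib sum_subtractf)

lemma contrasts_lincomb:
  assumes "g \<in> contrasts" "h \<in> contrasts"
  shows "(\<lambda>t. k * g t + l * h t) \<in> contrasts"
proof -
  obtain c d where "(\<Sum>b\<in>UNIV. c b) = 0" "g = (\<lambda>t. \<Sum>b\<in>UNIV. c b * \<phi> b t)"
    "(\<Sum>b\<in>UNIV. d b) = 0" "h = (\<lambda>t. \<Sum>b\<in>UNIV. d b * \<phi> b t)"
    using assms by (auto simp: contrasts_def)
  then show ?thesis
    unfolding contrasts_def
    by (intro CollectI exI[of _ "\<lambda>z. k * c z + l * d z"])
       (auto simp: distrib_right sum.distrib sum_distrib_left mult.assoc
             simp flip: sum_distrib_left)
qed

lemma contrasts_single_crossing: "g \<in> contrasts \<Longrightarrow> single_crossing_on {t0..t1} g"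
  using single_crossing by (auto simp: contrasts_def)

lemma contrasts_nonneg:
  "g \<in> contrasts \<Longrightarrow> t \<in> {t0..t1} \<Longrightarrow> 0 \<le> g t0 \<Longrightarrow> 0 \<le> g t1 \<Longrightarrow> 0 \<le> g t"
  by (rule single_crossing_on_interval(1)[OF contrasts_single_crossing])

lemma contrasts_pos:
  "g \<in> contrasts \<Longrightarrow> t \<in> {t0..t1} \<Longrightarrow> 0 < g t0 \<Longrightarrow> 0 < g t1 \<Longrightarrow> 0 < g t"
  by (rule single_crossing_on_interval(2)[OF contrasts_single_crossing])

lemma dominated:
  assumes "t \<in> {t0..t1}" "\<phi> b t0 \<le> \<phi> b' t0" "\<phi> b t1 \<le> \<phi> b' t1"
  shows "\<phi> b t \<le> \<phi> b' t"
  using contrasts_nonneg[OF contrasts_diff[of b' b] assms(1)] assms(2,3) by simp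

text \<open>Bundles tied at both ends dominate each other, hence tie at every type, against
  \<open>distinct\<close>. Thus Step 1 never discards two equivalent bundles in favour of each
  other.\<close>

lemma eq_endpoints_imp_eq:
  assumes "\<phi> b t0 = \<phi> b' t0" "\<phi> b t1 = \<phi> b' t1"
  shows "b = b'"
proof (rule ccontr)
  assume "b \<noteq> b'"
  then obtain t where "t \<in> {t0..t1}" "\<phi> b t \<noteq> \<phi> b' t"
    using distinct by blast
  with dominated[of t b b'] dominated[of t b' b] assms show False
    by simp
qed

text \<open>Adding a multiple of \<open>q\<close> to a multiple of \<open>g\<close> makes it positive at both ends without changing it
  at \<open>t\<close>.\<close>

lemma contrasts_pos_at_zero:
  assumes g: "g \<in> contrasts" and q: "q \<in> contrasts" and t: "t \<in> {t0..t1}" "q t = 0"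
    and "q t0 < 0" "0 < q t1" and "0 \<le> g t0" "0 \<le> g t1" "0 < g t0 \<or> 0 < g t1"
  shows "0 < g t"
proof -
  have pos: "0 < g t" if k: "0 < k" "0 < k * g t0 + l * q t0" "0 < k * g t1 + l * q t1" for k l
    using contrasts_pos[OF contrasts_lincomb[OF g q, of k l] t(1) k(2,3)] t(2) k(1)
    by (simp add: zero_less_mult_iff)
  from assms(9) show ?thesis
  proof
    assume "0 < g t0"
    show ?thesis
    proof (rule pos[of "1 - q t0 / g t0" 1])
      show k: "0 < 1 - q t0 / g t0"
        using \<open>0 < g t0\<close> assms(5) divide_neg_pos[of "q t0" "g t0"] by linarith
      show "0 < (1 - q t0 / g t0) * g t0 + 1 * q t0"
        using \<open>0 < g t0\<close> by (simp add: left_diff_distrib)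
      show "0 < (1 - q t0 / g t0) * g t1 + 1 * q t1"
        using k assms(6,8) by (simp add: add_nonneg_pos)
    qed
  next
    assume "0 < g t1"
    show ?thesis
    proof (rule pos[of "1 + q t1 / g t1" "- 1"])
      show k: "0 < 1 + q t1 / g t1"
        using \<open>0 < g t1\<close> assms(6) divide_pos_pos[of "q t1" "g t1"] by linarith
      show "0 < (1 + q t1 / g t1) * g t1 + - 1 * q t1"
        using \<open>0 < g t1\<close> by (simp add: distrib_right)
      show "0 < (1 + q t1 / g t1) * g t0 + - 1 * q t0"
        using k assms(5,7) mult_nonneg_nonneg[of "1 + q t1 / g t1" "g t0"] by linarith
    qed
  qed
qed

section \<open>One pass of Step 2, read as a comparison with chords\<close>

abbreviation ranked :: "'b list \<Rightarrow> bool" where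
  "ranked \<equiv> sorted_wrt (\<lambda>b b'. \<phi> b t0 > \<phi> b' t0 \<and> \<phi> b t1 < \<phi> b' t1)"

abbreviation removable_at :: "'b list \<Rightarrow> nat \<Rightarrow> bool" where
  "removable_at \<equiv> removable (\<lambda>b. \<phi> b t0) (\<lambda>b. \<phi> b t1)"

abbreviation step2 :: "'b list \<Rightarrow> 'b list" where
  "step2 \<equiv> elim_step2 (\<lambda>b. \<phi> b t0) (\<lambda>b. \<phi> b t1)"

abbreviation loop :: "'b list \<Rightarrow> 'b list" where
  "loop \<equiv> elim_loop (\<lambda>b. \<phi> b t0) (\<lambda>b. \<phi> b t1)"

lemma ranked_less:
  assumes "ranked bs" "i < j" "j < length bs"
  shows "\<phi> (bs ! j) t0 < \<phi> (bs ! i) t0" "\<phi> (bs ! i) t1 < \<phi> (bs ! j) t1"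
  using sorted_wrt_nth_less[OF assms] by auto

lemma ranked_nth_eq_iff:
  assumes "ranked bs" "i < length bs" "j < length bs"
  shows "bs ! i = bs ! j \<longleftrightarrow> i = j"
  using ranked_less(1)[OF assms(1), of i j] ranked_less(1)[OF assms(1), of j i] assms(2,3)
  by (cases i j rule: linorder_cases) auto

text \<open>Clears the denominators of the ratio test, whose signs are fixed by the ranking. The
  inequality \<open>B * C \<le> A * E\<close> says that the point of entry \<open>i\<close> lies on
  or below the chord through its two neighbours.\<close>

lemma chord_comparison:
  assumes "ranked bs" "1 \<le> i" "i + 1 < length bs"
  obtains A B C E where "A > 0" "B > 0" "C > 0" "E > 0"
    "A = \<phi> (bs ! (i - 1)) t0 - \<phi> (bs ! i) t0" "B = \<phi> (bs ! i) t0 - \<phi> (bs ! (i + 1)) t0"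
    "C = \<phi> (bs ! i) t1 - \<phi> (bs ! (i - 1)) t1" "E = \<phi> (bs ! (i + 1)) t1 - \<phi> (bs ! i) t1"
    "removable_at bs i \<longleftrightarrow> B * C \<le> A * E"
proof -
  define A where "A = \<phi> (bs ! (i - 1)) t0 - \<phi> (bs ! i) t0"
  define B where "B = \<phi> (bs ! i) t0 - \<phi> (bs ! (i + 1)) t0"
  define C where "C = \<phi> (bs ! i) t1 - \<phi> (bs ! (i - 1)) t1"
  define E where "E = \<phi> (bs ! (i + 1)) t1 - \<phi> (bs ! i) t1"
  have pos: "A > 0" "B > 0" "C > 0" "E > 0"
    using ranked_less[OF assms(1), of "i - 1" i] ranked_less[OF assms(1), of i "i + 1"] assms(2,3)
    by (auto simp: A_def B_def C_def E_def)
  have "removable_at bs i \<longleftrightarrow> (- B) / (- A) \<le> E / C"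
    using assms(2,3) by (simp add: removable_def A_def B_def C_def E_def)
  also have "\<dots> \<longleftrightarrow> B * C \<le> A * E"
    using pos by (simp add: field_simps)
  finally show thesis
    by (rule that[OF pos A_def B_def C_def E_def])
qed

text \<open>The weights \<open>B\<close> and \<open>A\<close>, normalized, give the lottery over the
  neighbours that ties with entry \<open>i\<close> at \<open>t0\<close>; by the chord inequality it
  is at least as good at \<open>t1\<close>, hence at every type.\<close>

lemma removable_below_chord:
  assumes "ranked bs" "removable_at bs i" "t \<in> {t0..t1}"
  obtains k l where "k > 0" "l > 0"
    "0 \<le> k * (\<phi> (bs ! (i - 1)) t - \<phi> (bs ! i) t) + l * (\<phi> (bs ! (i + 1)) t - \<phi> (bs ! i) t)"
proof -
  have i: "1 \<le> i" "i + 1 < length bs"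
    using assms(2) by (auto simp: removable_def)
  obtain A B C E where pos: "A > 0" "B > 0" "C > 0" "E > 0" and
    eq: "A = \<phi> (bs ! (i - 1)) t0 - \<phi> (bs ! i) t0" "B = \<phi> (bs ! i) t0 - \<phi> (bs ! (i + 1)) t0"
    "C = \<phi> (bs ! i) t1 - \<phi> (bs ! (i - 1)) t1" "E = \<phi> (bs ! (i + 1)) t1 - \<phi> (bs ! i) t1" and
    "removable_at bs i \<longleftrightarrow> B * C \<le> A * E"
    by (rule chord_comparison[OF assms(1) i])
  with assms(2) have le: "B * C \<le> A * E"
    by simp
  let ?g = "\<lambda>t. B * (\<phi> (bs ! (i - 1)) t - \<phi> (bs ! i) t) + A * (\<phi> (bs ! (i + 1)) t - \<phi> (bs ! i) t)"
  have "?g \<in> contrasts"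
    by (intro contrasts_lincomb contrasts_diff)
  moreover have "?g t0 = B * A + A * (- B)" "?g t1 = B * (- C) + A * E"
    by (simp_all add: eq)
  ultimately have "0 \<le> ?g t"
    using contrasts_nonneg[of ?g t] assms(3) le by simp
  with pos that show thesis
    by blast
qed

text \<open>Strictly above the chord there is room between \<open>E / C\<close> and
  \<open>B / A\<close>: any weight in that gap makes the combination positive at both ends, hence
  everywhere.\<close>

lemma not_removable_above_chord:
  assumes "ranked bs" "\<not> removable_at bs i" "1 \<le> i" "i + 1 < length bs" "t \<in> {t0..t1}"
  obtains k l where "k > 0" "l > 0"
    "0 < k * (\<phi> (bs ! i) t - \<phi> (bs ! (i - 1)) t) + l * (\<phi> (bs ! i) t - \<phi> (bs ! (i + 1)) t)"
proof -
  obtain A B C E where pos: "A > 0" "B > 0" "C > 0" "E > 0" and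
    eq: "A = \<phi> (bs ! (i - 1)) t0 - \<phi> (bs ! i) t0" "B = \<phi> (bs ! i) t0 - \<phi> (bs ! (i + 1)) t0"
    "C = \<phi> (bs ! i) t1 - \<phi> (bs ! (i - 1)) t1" "E = \<phi> (bs ! (i + 1)) t1 - \<phi> (bs ! i) t1" and
    "removable_at bs i \<longleftrightarrow> B * C \<le> A * E"
    by (rule chord_comparison[OF assms(1,3,4)])
  with assms(2) have "A * E < B * C"
    by simp
  with pos(1-4) have "E / C < B / A"
    by (auto simp: field_simps)
  then obtain k where k: "E / C < k" "k < B / A"
    using dense by blast
  have "0 < E / C"
    using pos by simp
  with k have "k > 0"
    by linarith
  let ?g = "\<lambda>t. k * (\<phi> (bs ! i) t - \<phi> (bs ! (i - 1)) t) + 1 * (\<phi> (bs ! i) t - \<phi> (bs ! (i + 1)) t)"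
  have "?g \<in> contrasts"
    by (intro contrasts_lincomb contrasts_diff)
  moreover have "?g t0 = k * (- A) + B" "?g t1 = k * C - E"
    by (simp_all add: eq)
  ultimately have "0 < ?g t"
    using contrasts_pos[of ?g t] assms(5) k pos by (simp add: field_simps)
  with \<open>k > 0\<close> that[of k 1] show thesis
    by simp
qed

text \<open>
  A removed maximizer lies strictly between two other maximizers, so that the first and the last
  maximizer of a list are never removed.
\<close>

lemma removable_neighbours_maximize:
  assumes "ranked bs" "removable_at bs i" "t \<in> {t0..t1}"
    and max: "\<forall>b\<in>set bs. \<phi> b t \<le> \<phi> (bs ! i) t"
  shows "\<phi> (bs ! (i - 1)) t = \<phi> (bs ! i) t" "\<phi> (bs ! (i + 1)) t = \<phi> (bs ! i) t"
proof -
  obtain k l where kl: "k > 0" "l > 0"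
    "0 \<le> k * (\<phi> (bs ! (i - 1)) t - \<phi> (bs ! i) t) + l * (\<phi> (bs ! (i + 1)) t - \<phi> (bs ! i) t)"
    by (rule removable_below_chord[OF assms(1-3)])
  have "i - 1 < length bs" "i + 1 < length bs"
    using assms(2) by (auto simp: removable_def)
  then have le: "\<phi> (bs ! (i - 1)) t - \<phi> (bs ! i) t \<le> 0" "\<phi> (bs ! (i + 1)) t - \<phi> (bs ! i) t \<le> 0"
    using max by auto
  then have "k * (\<phi> (bs ! (i - 1)) t - \<phi> (bs ! i) t) \<le> 0" "l * (\<phi> (bs ! (i + 1)) t - \<phi> (bs ! i) t) \<le> 0"
    using kl by (auto intro: mult_nonneg_nonpos)
  with kl have "k * (\<phi> (bs ! (i - 1)) t - \<phi> (bs ! i) t) = 0" "l * (\<phi> (bs ! (i + 1)) t - \<phi> (bs ! i) t) = 0"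
    by linarith+
  with kl show "\<phi> (bs ! (i - 1)) t = \<phi> (bs ! i) t" "\<phi> (bs ! (i + 1)) t = \<phi> (bs ! i) t"
    by auto
qed

lemma set_step2: "set (step2 bs) = {bs ! i | i. i < length bs \<and> \<not> removable_at bs i}"
  by (auto simp: elim_step2_def set_nths)

text \<open>Since a pass removes simultaneously, the neighbours of a removed maximizer may vanish as
  well, so survival is claimed only for the outermost maximizers. That they enclose all other
  maximizers is what later turns uniqueness after the pass into uniqueness before it.\<close>

lemma extreme_maximizers_survive_step2:
  assumes "ranked bs" "bs \<noteq> []" "t \<in> {t0..t1}"
  obtains i j where "i < length bs" "j < length bs" "bs ! i \<in> set (step2 bs)" "bs ! j \<in> set (step2 bs)"
    "\<forall>b\<in>set bs. \<phi> b t \<le> \<phi> (bs ! i) t" "\<forall>b\<in>set bs. \<phi> b t \<le> \<phi> (bs ! j) t"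
    "\<forall>k<length bs. \<phi> (bs ! k) t = \<phi> (bs ! i) t \<longrightarrow> i \<le> k \<and> k \<le> j"
proof -
  define I where "I = {i. i < length bs \<and> (\<forall>b\<in>set bs. \<phi> b t \<le> \<phi> (bs ! i) t)}"
  have fin: "finite I"
    by (simp add: I_def)
  obtain b where b: "b \<in> set bs" "\<forall>b'\<in>set bs. \<phi> b' t \<le> \<phi> b t"
    using ex_is_arg_min_if_finite[of "set bs" "\<lambda>b. - \<phi> b t"] assms(2)
    by (force simp: is_arg_min_def not_less)
  then have ne: "I \<noteq> {}"
    by (auto simp: I_def in_set_conv_nth)
  have Min: "Min I \<in> I" and Max: "Max I \<in> I"
    using fin ne by auto
  have "\<not> removable_at bs (Min I)"
  proof
    assume rem: "removable_at bs (Min I)"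
    then have "\<phi> (bs ! (Min I - 1)) t = \<phi> (bs ! Min I) t"
      using removable_neighbours_maximize(1)[OF assms(1) rem assms(3)] Min by (simp add: I_def)
    moreover have "Min I - 1 < length bs"
      using Min by (simp add: I_def less_imp_diff_less)
    ultimately have "Min I - 1 \<in> I"
      using Min by (simp add: I_def)
    \<comment> \<open>With truncated subtraction this forces index 0, which is never
      removable.\<close>
    then have "Min I \<le> Min I - 1"
      using fin by simp
    then show False
      using rem by (auto simp: removable_def)
  qed
  moreover have "\<not> removable_at bs (Max I)"
  proof
    assume rem: "removable_at bs (Max I)"
    then have "\<phi> (bs ! (Max I + 1)) t = \<phi> (bs ! Max I) t"
      using removable_neighbours_maximize(2)[OF assms(1) rem assms(3)] Max by (simp add: I_def)
    then have "Max I + 1 \<in> I"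
      using Max rem by (simp add: I_def removable_def)
    then have "Max I + 1 \<le> Max I"
      using fin Max_ge by blast
    then show False
      by simp
  qed
  moreover have "\<forall>k<length bs. \<phi> (bs ! k) t = \<phi> (bs ! Min I) t \<longrightarrow> k \<in> I"
    using Min by (auto simp: I_def)
  then have "\<forall>k<length bs. \<phi> (bs ! k) t = \<phi> (bs ! Min I) t \<longrightarrow> Min I \<le> k \<and> k \<le> Max I"
    using fin by auto
  ultimately show thesis
    using that[of "Min I" "Max I"] Min Max by (auto simp: I_def set_step2)
qed

lemma ranked_step2: "ranked bs \<Longrightarrow> ranked (step2 bs)"
proof -
  have "sorted_wrt R (nths xs I)" if "sorted_wrt R xs" for R and xs :: "'b list" and I
    using that by (induction xs arbitrary: I) (auto simp: nths_Cons dest: in_set_nthsD)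
  then show "ranked bs \<Longrightarrow> ranked (step2 bs)"
    by (simp add: elim_step2_def)
qed

lemma set_step2_subset: "set (step2 bs) \<subseteq> set bs"
  by (auto simp: elim_step2_def dest: in_set_nthsD)

lemma step2_attains_max:
  assumes "ranked bs" "t \<in> {t0..t1}" "b \<in> set bs"
  shows "\<exists>b'\<in>set (step2 bs). \<phi> b t \<le> \<phi> b' t"
proof -
  have "bs \<noteq> []"
    using assms(3) by auto
  then show ?thesis
    using extreme_maximizers_survive_step2[OF assms(1) _ assms(2)] assms(3) by metis
qed

text \<open>Both outermost maximizers survive, so both are the unique surviving maximizer
  \<open>c\<close>; nothing fits between equal positions.\<close>

lemma step2_unique_max:
  assumes "ranked bs" "t \<in> {t0..t1}" "c \<in> set (step2 bs)"
    and uniq: "\<forall>b\<in>set (step2 bs). b \<noteq> c \<longrightarrow> \<phi> b t < \<phi> c t"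
    and "b \<in> set bs" "b \<noteq> c"
  shows "\<phi> b t < \<phi> c t"
proof -
  have "bs \<noteq> []"
    using assms(5) by auto
  then obtain i j where ij: "i < length bs" "j < length bs"
    "bs ! i \<in> set (step2 bs)" "bs ! j \<in> set (step2 bs)"
    "\<forall>b\<in>set bs. \<phi> b t \<le> \<phi> (bs ! i) t" "\<forall>b\<in>set bs. \<phi> b t \<le> \<phi> (bs ! j) t"
    "\<forall>k<length bs. \<phi> (bs ! k) t = \<phi> (bs ! i) t \<longrightarrow> i \<le> k \<and> k \<le> j"
    by (rule extreme_maximizers_survive_step2[OF assms(1) _ assms(2)])
  have "c \<in> set bs"
    using assms(3) set_step2_subset by auto
  then have c: "bs ! i = c" "bs ! j = c"
    using ij uniq by (metis not_le)+
  then have "i = j"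
    using ranked_nth_eq_iff[OF assms(1) ij(1,2)] by simp
  obtain k where k: "k < length bs" "b = bs ! k"
    using assms(5) by (auto simp: in_set_conv_nth)
  then have "\<phi> b t \<noteq> \<phi> c t"
    using ij(7) \<open>i = j\<close> c assms(6) by (metis le_antisym)
  moreover have "\<phi> b t \<le> \<phi> c t"
    using ij(5) c assms(5) by auto
  ultimately show ?thesis
    by simp
qed

text \<open>Relates the input of the loop to its output: prepending a pass changes the former and
  leaves the latter alone. The ranking is carried along as an invariant.\<close>

lemma loop_induct [consumes 1, case_names base step]:
  assumes "ranked bs"
    and base: "\<And>bs. ranked bs \<Longrightarrow> \<forall>i<length bs. \<not> removable_at bs i \<Longrightarrow> P bs bs"
    and step: "\<And>bs. ranked bs \<Longrightarrow> P (step2 bs) (loop (step2 bs)) \<Longrightarrow> P bs (loop (step2 bs))"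
  shows "P bs (loop bs)"
  using assms(1)
proof (induction "\<lambda>b. \<phi> b t0" "\<lambda>b. \<phi> b t1" bs rule: elim_loop.induct)
  case (1 bs)
  show ?case
  proof (cases "\<exists>i<length bs. removable_at bs i")
    case False
    have "loop bs = bs"
      by (subst elim_loop.simps) (rule if_not_P[OF False])
    moreover have "P bs bs"
      using 1(2) False by (intro base) auto
    ultimately show ?thesis
      by (simp only:)
  next
    case True
    have "loop bs = loop (step2 bs)"
      by (subst elim_loop.simps) (rule if_P[OF True])
    moreover have "P bs (loop (step2 bs))"
      by (rule step[OF 1(2) 1(1)[OF True ranked_step2[OF 1(2)]]])
    ultimately show ?thesis
      by (simp only:)
  qed
qed

lemma ranked_loop: "ranked bs \<Longrightarrow> ranked (loop bs)"
  by (induction rule: loop_induct)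

lemma set_loop_subset: "ranked bs \<Longrightarrow> set (loop bs) \<subseteq> set bs"
proof (induction rule: loop_induct)
  case (step bs)
  then show ?case
    using set_step2_subset by (meson order_trans)
qed simp

lemma loop_not_removable: "ranked bs \<Longrightarrow> \<forall>i<length (loop bs). \<not> removable_at (loop bs) i"
  by (induction rule: loop_induct)

lemma loop_attains_max:
  assumes "ranked bs" "t \<in> {t0..t1}"
  shows "\<forall>b\<in>set bs. \<exists>b'\<in>set (loop bs). \<phi> b t \<le> \<phi> b' t"
  using assms(1)
proof (induction rule: loop_induct)
  case (step bs)
  show ?case
  proof
    fix b assume "b \<in> set bs"
    then obtain b' where b': "b' \<in> set (step2 bs)" "\<phi> b t \<le> \<phi> b' t"
      using step2_attains_max[OF step.hyps assms(2)] by blast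
    with step.IH obtain b'' where "b'' \<in> set (loop (step2 bs))" "\<phi> b' t \<le> \<phi> b'' t"
      by blast
    with b'(2) show "\<exists>b'\<in>set (loop (step2 bs)). \<phi> b t \<le> \<phi> b' t"
      by (intro bexI[of _ b'']) auto
  qed
qed auto

lemma loop_unique_max:
  assumes "ranked bs" "t \<in> {t0..t1}"
  shows "\<forall>c\<in>set (loop bs). (\<forall>b\<in>set (loop bs). b \<noteq> c \<longrightarrow> \<phi> b t < \<phi> c t) \<longrightarrow>
           (\<forall>b\<in>set bs. b \<noteq> c \<longrightarrow> \<phi> b t < \<phi> c t)"
  using assms(1)
proof (induction rule: loop_induct)
  case (step bs)
  show ?case
  proof (intro ballI impI)
    fix b c assume c: "c \<in> set (loop (step2 bs))"
      and uniq: "\<forall>b\<in>set (loop (step2 bs)). b \<noteq> c \<longrightarrow> \<phi> b t < \<phi> c t" and b: "b \<in> set bs" "b \<noteq> c"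
    show "\<phi> b t < \<phi> c t"
    proof (rule step2_unique_max[OF step.hyps assms(2) _ _ b])
      show "c \<in> set (step2 bs)"
        using set_loop_subset[OF ranked_step2[OF step.hyps]] c by blast
      show "\<forall>b\<in>set (step2 bs). b \<noteq> c \<longrightarrow> \<phi> b t < \<phi> c t"
        using step.IH c uniq by blast
    qed
  qed
qed auto

section \<open>The output list and its pointwise maximizers\<close>

definition undominated :: "'b set" where
  "undominated = elim_step1 (\<lambda>b. \<phi> b t0) (\<lambda>b. \<phi> b t1) UNIV"

definition output_list :: "'b list" where
  "output_list = loop (sorted_key_list_of_set (\<lambda>b. - \<phi> b t0) undominated)"

lemma set_output_list:
  "set output_list = elimination_output (\<lambda>b. \<phi> b t0) (\<lambda>b. \<phi> b t1) UNIV"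
  by (simp add: output_list_def undominated_def elimination_output_def)

text \<open>Among all bundles that dominate \<open>b\<close>, one with the largest sum of the two
  end values cannot be dominated in turn: a dominator would tie with it at both ends.\<close>

lemma undominated_dominates:
  obtains b' where "b' \<in> undominated" "\<phi> b t0 \<le> \<phi> b' t0" "\<phi> b t1 \<le> \<phi> b' t1"
proof -
  define D where "D = {b'. \<phi> b t0 \<le> \<phi> b' t0 \<and> \<phi> b t1 \<le> \<phi> b' t1}"
  have "finite D" "D \<noteq> {}"
    by (auto simp: D_def)
  then obtain b' where b': "b' \<in> D" "\<And>c. c \<in> D \<Longrightarrow> \<phi> c t0 + \<phi> c t1 \<le> \<phi> b' t0 + \<phi> b' t1"
    using ex_is_arg_min_if_finite[of D "\<lambda>c. - (\<phi> c t0 + \<phi> c t1)"]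
    by (force simp: is_arg_min_def not_less)
  have "b' \<in> undominated"
    unfolding undominated_def elim_step1_def
  proof (clarsimp)
    fix c assume c: "c \<noteq> b'" "\<phi> b' t1 \<le> \<phi> c t1" "\<phi> b' t0 \<le> \<phi> c t0"
    then have "c \<in> D"
      using b'(1) by (auto simp: D_def)
    from b'(2)[OF this] c have "\<phi> b' t0 = \<phi> c t0" "\<phi> b' t1 = \<phi> c t1"
      by linarith+
    from eq_endpoints_imp_eq[OF this] c(1) show False
      by simp
  qed
  then show thesis
    using that b'(1) by (auto simp: D_def)
qed

lemma initial_listing:
  defines "bs \<equiv> sorted_key_list_of_set (\<lambda>b. - \<phi> b t0) undominated"
  shows "set bs = undominated" "ranked bs"
  using elim_step1_listing[of "UNIV :: 'b set" "\<lambda>b. \<phi> b t0" "\<lambda>b. \<phi> b t1"]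
  by (auto simp: bs_def undominated_def)

lemma output_ranked: "ranked output_list"
  unfolding output_list_def by (rule ranked_loop[OF initial_listing(2)])

lemma output_not_removable: "i < length output_list \<Longrightarrow> \<not> removable_at output_list i"
  using loop_not_removable[OF initial_listing(2)] unfolding output_list_def by blast

lemma output_unique_max_undominated:
  assumes "t \<in> {t0..t1}" "c \<in> set output_list"
    and "\<And>b. b \<in> set output_list \<Longrightarrow> b \<noteq> c \<Longrightarrow> \<phi> b t < \<phi> c t"
    and "b \<in> undominated" "b \<noteq> c"
  shows "\<phi> b t < \<phi> c t"
  using loop_unique_max[OF initial_listing(2) assms(1)] assms(2-5) initial_listing(1)
  unfolding output_list_def by blast

lemma output_attains_max:
  assumes "t \<in> {t0..t1}"
  obtains b' where "b' \<in> set output_list" "\<phi> b t \<le> \<phi> b' t"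
proof -
  obtain c where c: "c \<in> undominated" "\<phi> b t0 \<le> \<phi> c t0" "\<phi> b t1 \<le> \<phi> c t1"
    by (rule undominated_dominates)
  obtain b' where "b' \<in> set output_list" "\<phi> c t \<le> \<phi> b' t"
    using loop_attains_max[OF initial_listing(2) assms] c(1) initial_listing(1)
    unfolding output_list_def by blast
  with dominated[OF assms c(2,3)] that[of b'] show thesis
    by simp
qed

text \<open>A positive combination of the two differences is positive, so they cannot both be
  nonpositive. Consequently no interior entry of the output is a weak local minimum, at any
  type.\<close>

lemma output_concave:
  assumes "0 < j" "j + 1 < length output_list" "t \<in> {t0..t1}"
  shows "\<phi> (output_list ! j) t > \<phi> (output_list ! (j - 1)) t \<or>
         \<phi> (output_list ! j) t > \<phi> (output_list ! (j + 1)) t"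
proof (rule ccontr)
  assume neg: "\<not> ?thesis"
  obtain k l where kl: "k > 0" "l > 0"
    "0 < k * (\<phi> (output_list ! j) t - \<phi> (output_list ! (j - 1)) t)
       + l * (\<phi> (output_list ! j) t - \<phi> (output_list ! (j + 1)) t)"
    using not_removable_above_chord[OF output_ranked output_not_removable _ _ assms(3), of j] assms(1,2)
    by auto
  moreover have "k * (\<phi> (output_list ! j) t - \<phi> (output_list ! (j - 1)) t) \<le> 0"
    "l * (\<phi> (output_list ! j) t - \<phi> (output_list ! (j + 1)) t) \<le> 0"
    using kl(1,2) neg by (auto intro!: mult_nonneg_nonpos)
  ultimately show False
    by linarith
qed

text \<open>Without weak local minima in the interior, a sequence that has started to fall on one
  side keeps falling, so beating the two neighbours means beating the whole list.\<close>

lemma output_unimodal: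
  assumes "i < length output_list" "t \<in> {t0..t1}"
    and "0 < i \<Longrightarrow> \<phi> (output_list ! (i - 1)) t < \<phi> (output_list ! i) t"
    and "i + 1 < length output_list \<Longrightarrow> \<phi> (output_list ! (i + 1)) t < \<phi> (output_list ! i) t"
    and "b \<in> set output_list" "b \<noteq> output_list ! i"
  shows "\<phi> b t < \<phi> (output_list ! i) t"
proof -
  let ?h = "\<lambda>j. \<phi> (output_list ! j) t"
  \<comment> \<open>The second conjunct carries the induction: it excludes one alternative of
    \<open>output_concave\<close> and leaves a further decrease.\<close>
  have down: "?h (i - d) < ?h i \<and> ?h (i - d) < ?h (i - d + 1)" if "1 \<le> d" "d \<le> i" for d
    using that
  proof (induction d rule: dec_induct)
    case base
    then show ?case using assms(3) by simp
  next
    case (step d)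
    then have "?h (i - d) < ?h i" "?h (i - d) < ?h (i - d + 1)"
      by auto
    moreover have "?h (i - d) > ?h (i - d - 1) \<or> ?h (i - d) > ?h (i - d + 1)"
      using step assms(1,2) by (intro output_concave) auto
    ultimately show ?case
      using step.prems by (auto simp: Suc_diff_Suc)
  qed
  have up: "?h (i + d) < ?h i \<and> ?h (i + d) < ?h (i + d - 1)" if "1 \<le> d" "i + d < length output_list" for d
    using that
  proof (induction d rule: dec_induct)
    case base
    then show ?case using assms(4) by simp
  next
    case (step d)
    then have "?h (i + d) < ?h i" "?h (i + d) < ?h (i + d - 1)"
      by auto
    moreover have "?h (i + d) > ?h (i + d - 1) \<or> ?h (i + d) > ?h (i + d + 1)"
      using step assms(1,2) by (intro output_concave) auto
    ultimately show ?case
      by auto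
  qed
  obtain j where j: "j < length output_list" "b = output_list ! j"
    using assms(5) by (auto simp: in_set_conv_nth)
  with assms(6) consider "j < i" | "i < j"
    by (metis linorder_neqE_nat)
  then show ?thesis
  proof cases
    case 1
    then show ?thesis using down[of "i - j"] j by auto
  next
    case 2
    then show ?thesis using up[of "j - i"] j by auto
  qed
qed

text \<open>
  The witness lies just to the right of the last zero \<open>s\<close> of the difference \<open>q\<close> between \<open>c\<close> and its
  predecessor: there \<open>c\<close> overtakes its predecessor but is still ahead of its successor. Bundles
  dominated by \<open>c\<close> at both ends are strictly worse at \<open>s\<close>, because \<open>q\<close> vanishes there.
\<close>

lemma output_strictly_best_somewhere:
  assumes c: "c \<in> set output_list"
  obtains \<tau> where "\<tau> \<in> {t0..t1}" "\<And>b. b \<noteq> c \<Longrightarrow> \<phi> b \<tau> < \<phi> c \<tau>"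
proof -
  obtain i where i: "i < length output_list" "c = output_list ! i"
    using c by (auto simp: in_set_conv_nth)
  note witness = that
  \<comment> \<open>Every \<open>b\<close> is dominated by some undominated \<open>b'\<close>. If
    \<open>b'\<close> differs from \<open>c\<close>, beating the neighbours in the list is enough;
    only bundles dominated by \<open>c\<close> itself need the separate condition 3.\<close>
  have conclude: thesis if \<tau>: "\<tau> \<in> {t0..t1}"
    and 1: "0 < i \<Longrightarrow> \<phi> (output_list ! (i - 1)) \<tau> < \<phi> c \<tau>"
    and 2: "i + 1 < length output_list \<Longrightarrow> \<phi> (output_list ! (i + 1)) \<tau> < \<phi> c \<tau>"
    and 3: "\<And>b. b \<noteq> c \<Longrightarrow> \<phi> b t0 \<le> \<phi> c t0 \<Longrightarrow> \<phi> b t1 \<le> \<phi> c t1 \<Longrightarrow> \<phi> b \<tau> < \<phi> c \<tau>" for \<tau>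
  proof (rule witness[OF \<tau>])
    fix b assume "b \<noteq> c"
    obtain b' where b': "b' \<in> undominated" "\<phi> b t0 \<le> \<phi> b' t0" "\<phi> b t1 \<le> \<phi> b' t1"
      by (rule undominated_dominates)
    show "\<phi> b \<tau> < \<phi> c \<tau>"
    proof (cases "b' = c")
      case True
      with 3 b' \<open>b \<noteq> c\<close> show ?thesis by blast
    next
      case False
      have "\<phi> b' \<tau> < \<phi> c \<tau>"
      proof (rule output_unique_max_undominated[OF \<tau> c _ b'(1) False])
        show "\<phi> b \<tau> < \<phi> c \<tau>" if "b \<in> set output_list" "b \<noteq> c" for b
          using output_unimodal[OF i(1) \<tau> _ _ that(1)] that(2) 1 2 unfolding i(2) by blast
      qed
      with dominated[OF \<tau> b'(2,3)] show ?thesis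
        by simp
    qed
  qed
  have t0: "t0 \<in> {t0..t1}"
    using t0_less_t1 by simp
  show thesis
  proof (cases "c = e")
    case True
    with initially_best show thesis
      using witness[OF t0] by blast
  next
    case False
    obtain e' where "e' \<in> set output_list" "\<phi> e t0 \<le> \<phi> e' t0"
      by (rule output_attains_max[OF t0])
    then have "e \<in> set output_list"
      using initially_best[of e'] by (cases "e' = e") auto
    then obtain j where j: "j < length output_list" "output_list ! j = e"
      by (auto simp: in_set_conv_nth)
    \<comment> \<open>The list decreases in the values at \<open>t0\<close> and \<open>e\<close> is
      strictly best there, so \<open>e\<close> comes first and any other entry has a
      predecessor.\<close>
    have "0 < i"
    proof (rule ccontr)
      assume "\<not> 0 < i"
      then have "i < j"
        using False i j by (cases j) auto
      then show False
        using ranked_less(1)[OF output_ranked, of i j] i j initially_best[of c] False by simp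
    qed
    define q where "q = (\<lambda>t. \<phi> c t - \<phi> (output_list ! (i - 1)) t)"
    have q: "q \<in> contrasts"
      unfolding q_def by (rule contrasts_diff)
    have q_t0: "q t0 < 0" and q_t1: "0 < q t1"
      using ranked_less[OF output_ranked, of "i - 1" i] i \<open>0 < i\<close> by (auto simp: q_def)
    have cont_q: "continuous_on {t0..t1} q"
      unfolding q_def by (intro continuous_intros continuous)
    define Z where "Z = {t \<in> {t0..t1}. q t = 0}"
    \<comment> \<open>By the intermediate value theorem, a nonpositive value of \<open>q\<close>
      forces a zero at or after it; beyond the last zero \<open>q\<close> is therefore
      positive.\<close>
    have zero_between: "\<exists>z. t \<le> z \<and> z \<le> t1 \<and> q z = 0" if "t \<in> {t0..t1}" "q t \<le> 0" for t
      using IVT'[of q t 0 t1] that q_t1 continuous_on_subset[OF cont_q, of "{t..t1}"] by auto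
    have "Z \<noteq> {}"
      using zero_between[OF t0] q_t0 by (auto simp: Z_def)
    moreover have "compact Z"
      unfolding Z_def
      by (intro compact_Icc continuous_closedin_preimage_constant[OF cont_q, THEN closedin_compact[rotated]])
    ultimately obtain s where s: "s \<in> Z" "\<And>z. z \<in> Z \<Longrightarrow> z \<le> s"
      using compact_attains_sup[of Z] by blast
    then have s': "s \<in> {t0..t1}" "q s = 0"
      by (auto simp: Z_def)
    then have "s < t1"
      using q_t1 by (cases "s = t1") auto
    have q_pos: "0 < q t" if t: "s < t" "t \<le> t1" for t
    proof (rule ccontr)
      assume "\<not> 0 < q t"
      then obtain z where "t \<le> z" "z \<le> t1" "q z = 0"
        using zero_between[of t] t s' by auto
      then show False
        using s(2)[of z] t s' by (auto simp: Z_def)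
    qed
    have near: "\<forall>\<^sub>F t in at_right s. \<phi> b t < \<phi> c t" if "\<phi> b s < \<phi> c s" for b
    proof -
      have "continuous_on {s..t1} (\<lambda>t. \<phi> c t - \<phi> b t)"
        using s' by (intro continuous_intros continuous_on_subset[OF continuous]) auto
      then have "((\<lambda>t. \<phi> c t - \<phi> b t) \<longlongrightarrow> \<phi> c s - \<phi> b s) (at s within {s..t1})"
        using \<open>s < t1\<close> by (simp add: continuous_on_def)
      then have "((\<lambda>t. \<phi> c t - \<phi> b t) \<longlongrightarrow> \<phi> c s - \<phi> b s) (at_right s)"
        using \<open>s < t1\<close> by (simp add: at_within_Icc_at_right)
      from order_tendstoD(1)[OF this, of 0] that show ?thesis
        by simp
    qed
    have "\<forall>\<^sub>F t in at_right s. s < t \<and> t < t1"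
      using \<open>s < t1\<close> by (auto simp: eventually_at_right)
    moreover have "\<forall>\<^sub>F t in at_right s. i + 1 < length output_list \<longrightarrow> \<phi> (output_list ! (i + 1)) t < \<phi> c t"
    proof (cases "i + 1 < length output_list")
      case True
      \<comment> \<open>At \<open>s\<close> the entry \<open>c\<close> ties with its predecessor, so
        \<open>output_concave\<close> leaves only the strict lead over the successor.\<close>
      with output_concave[OF \<open>0 < i\<close> True s'(1)] s'(2) i(2)
      have "\<phi> (output_list ! (i + 1)) s < \<phi> c s"
        by (auto simp: q_def)
      with near show ?thesis by auto
    qed simp
    moreover have "\<forall>\<^sub>F t in at_right s. \<forall>b\<in>{b. b \<noteq> c \<and> \<phi> b t0 \<le> \<phi> c t0 \<and> \<phi> b t1 \<le> \<phi> c t1}. \<phi> b t < \<phi> c t"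
    proof (intro eventually_ball_finite finite ballI near, elim CollectE conjE)
      fix b assume b: "b \<noteq> c" "\<phi> b t0 \<le> \<phi> c t0" "\<phi> b t1 \<le> \<phi> c t1"
      then have "0 < \<phi> c t0 - \<phi> b t0 \<or> 0 < \<phi> c t1 - \<phi> b t1"
        using eq_endpoints_imp_eq[of b c] by linarith
      from contrasts_pos_at_zero[OF contrasts_diff q s' q_t0 q_t1 _ _ this] b
      show "\<phi> b s < \<phi> c s" by simp
    qed
    ultimately have "\<forall>\<^sub>F t in at_right s. (s < t \<and> t < t1) \<and>
        (i + 1 < length output_list \<longrightarrow> \<phi> (output_list ! (i + 1)) t < \<phi> c t) \<and>
        (\<forall>b\<in>{b. b \<noteq> c \<and> \<phi> b t0 \<le> \<phi> c t0 \<and> \<phi> b t1 \<le> \<phi> c t1}. \<phi> b t < \<phi> c t)"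
      by eventually_elim blast
    then obtain \<tau> where \<tau>: "s < \<tau>" "\<tau> < t1"
        "i + 1 < length output_list \<Longrightarrow> \<phi> (output_list ! (i + 1)) \<tau> < \<phi> c \<tau>"
        "\<And>b. b \<noteq> c \<Longrightarrow> \<phi> b t0 \<le> \<phi> c t0 \<Longrightarrow> \<phi> b t1 \<le> \<phi> c t1 \<Longrightarrow> \<phi> b \<tau> < \<phi> c \<tau>"
      using eventually_happens'[OF trivial_limit_at_right_real] by blast
    show thesis
    proof (rule conclude)
      show "\<tau> \<in> {t0..t1}" using \<tau> s' by simp
      show "\<phi> (output_list ! (i - 1)) \<tau> < \<phi> c \<tau>" using q_pos[of \<tau>] \<tau> by (simp add: q_def)
    qed (use \<tau> in auto)
  qed
qed

end

section \<open>Integration of one-sided growth bounds\<close>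

text \<open>
  If \<open>H\<close> grows at rate at least \<open>K\<close> uniformly, averaging the difference quotients of \<open>H\<close> over
  \<open>{s..t - h}\<close> makes them telescope, so that the inequality survives integration although \<open>H\<close> need
  not be differentiable with derivative \<open>K\<close> anywhere.
\<close>

lemma integral_le_increment:
  fixes H K :: "real \<Rightarrow> real"
  assumes "s < t" and H: "continuous_on {s..t} H" and K: "K integrable_on {s..t}"
    and inc: "\<And>\<epsilon>. \<epsilon> > 0 \<Longrightarrow> \<exists>\<delta>>0. \<forall>r h. s \<le> r \<and> 0 < h \<and> h < \<delta> \<and> r + h \<le> t \<longrightarrow>
      h * (K r - \<epsilon>) \<le> H (r + h) - H r"
  shows "integral {s..t} K \<le> H t - H s"
proof -
  \<comment> \<open>The telescoped averages are difference quotients of the antiderivative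
    \<open>P\<close> at the two ends of the interval.\<close>
  define P where "P = (\<lambda>x. integral {s..x} H)"
  have P: "(P has_vector_derivative H x) (at x within {s..t})" if "x \<in> {s..t}" for x
    unfolding P_def by (rule integral_has_vector_derivative[OF H that])
  have lim_s: "((\<lambda>h. (P (s + h) - P s) / h) \<longlongrightarrow> H s) (at_right 0)"
  proof -
    have "(P has_field_derivative H s) (at_right s)"
      using P[of s] \<open>s < t\<close>
      by (simp add: has_real_derivative_iff_has_vector_derivative at_within_Icc_at_right)
    then show ?thesis
      unfolding has_field_derivative_iff by (subst (asm) filterlim_at_right_to_0) (simp add: add.commute)
  qed
  have lim_t: "((\<lambda>h. (P t - P (t - h)) / h) \<longlongrightarrow> H t) (at_right 0)"
  proof -
    have "(P has_field_derivative H t) (at_left t)"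
      using P[of t] \<open>s < t\<close>
      by (simp add: has_real_derivative_iff_has_vector_derivative at_within_Icc_at_left)
    then have "((\<lambda>h. (P (t - h) - P t) / (t - h - t)) \<longlongrightarrow> H t) (at_right 0)"
      unfolding has_field_derivative_iff
      by (subst (asm) filterlim_at_left_to_right, subst (asm) filterlim_at_right_to_0) simp
    moreover have "(P (t - h) - P t) / (t - h - t) = (P t - P (t - h)) / h" for h
      by (cases "h = 0") (auto simp: field_simps)
    ultimately show ?thesis
      by simp
  qed
  have lim_K: "((\<lambda>h. integral {s..t - h} K) \<longlongrightarrow> integral {s..t} K) (at_right 0)"
  proof -
    have "continuous_on {s..t} (\<lambda>x. integral {s..x} K)"
      by (rule indefinite_integral_continuous_1[OF K])
    then have "((\<lambda>x. integral {s..x} K) \<longlongrightarrow> integral {s..t} K) (at t within {s..t})"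
      using \<open>s < t\<close> by (simp add: continuous_on_def)
    then have "((\<lambda>x. integral {s..x} K) \<longlongrightarrow> integral {s..t} K) (at_left t)"
      using \<open>s < t\<close> by (simp add: at_within_Icc_at_left)
    then show ?thesis
      by (subst (asm) filterlim_at_left_to_right, subst (asm) filterlim_at_right_to_0) simp
  qed
  have "integral {s..t} K \<le> H t - H s + e" if "e > 0" for e
  proof -
    \<comment> \<open>An error rate \<open>\<epsilon>\<close> accumulates to \<open>e\<close> over
      the length \<open>t - s\<close>.\<close>
    define \<epsilon> where "\<epsilon> = e / (t - s)"
    have "\<epsilon> > 0"
      using \<open>s < t\<close> that by (simp add: \<epsilon>_def)
    from inc[OF this] obtain \<delta> where \<delta>: "\<delta> > 0"
      "\<And>r h. s \<le> r \<Longrightarrow> 0 < h \<Longrightarrow> h < \<delta> \<Longrightarrow> r + h \<le> t \<Longrightarrow> h * (K r - \<epsilon>) \<le> H (r + h) - H r"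
      by blast
    have quotient: "integral {s..t - h} K - \<epsilon> * (t - h - s)
        \<le> (P t - P (t - h)) / h - (P (s + h) - P s) / h" if h: "0 < h" "h < \<delta>" "h < t - s" for h
    proof -
      have K': "K integrable_on {s..t - h}"
        by (rule integrable_on_subinterval[OF K]) (use h in auto)
      have shift: "((\<lambda>r. H (r + h)) has_integral integral {s + h..t} H) {s..t - h}"
      proof -
        have "continuous_on {s + h..t} H"
          by (rule continuous_on_subset[OF H]) (use h in auto)
        from has_integral_shift_real_ivl[OF integrable_integral[OF integrable_continuous_real[OF this]], of h]
        show ?thesis by simp
      qed
      have H': "H integrable_on {s..t - h}"
        by (rule integrable_continuous_real[OF continuous_on_subset[OF H]]) (use h in auto)
      have "((\<lambda>r. h * (K r - \<epsilon>)) has_integral h * (integral {s..t - h} K - \<epsilon> * (t - h - s))) {s..t - h}"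
        using has_integral_mult_right[OF has_integral_diff[OF integrable_integral[OF K']
              has_integral_const_real[of \<epsilon> s "t - h"]], of h] h
        by (simp add: mult.commute)
      moreover have "((\<lambda>r. H (r + h) - H r) has_integral integral {s + h..t} H - integral {s..t - h} H) {s..t - h}"
        by (rule has_integral_diff[OF shift integrable_integral[OF H']])
      ultimately have "h * (integral {s..t - h} K - \<epsilon> * (t - h - s))
          \<le> integral {s + h..t} H - integral {s..t - h} H"
        by (rule has_integral_le) (use \<delta>(2) h in auto)
      also have "integral {s + h..t} H = P t - P (s + h)"
        using Henstock_Kurzweil_Integration.integral_combine[OF _ _ integrable_continuous_real[OF H], of "s + h"] h
        by (simp add: P_def)
      finally have "h * (integral {s..t - h} K - \<epsilon> * (t - h - s))
          \<le> (P t - P (t - h)) - (P (s + h) - P s)"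
        by (simp add: P_def)
      with h(1) show ?thesis
        by (simp add: pos_le_divide_eq mult.commute flip: diff_divide_distrib)
    qed
    have "((\<lambda>h. integral {s..t - h} K - \<epsilon> * (t - h - s)) \<longlongrightarrow> integral {s..t} K - \<epsilon> * (t - 0 - s)) (at_right 0)"
      by (intro tendsto_intros lim_K)
    moreover have "((\<lambda>h. (P t - P (t - h)) / h - (P (s + h) - P s) / h) \<longlongrightarrow> H t - H s) (at_right 0)"
      by (intro tendsto_intros lim_s lim_t)
    moreover have "\<forall>\<^sub>F h in at_right 0. integral {s..t - h} K - \<epsilon> * (t - h - s)
        \<le> (P t - P (t - h)) / h - (P (s + h) - P s) / h"
      unfolding eventually_at_right_field
      using \<delta>(1) \<open>s < t\<close> quotient by (intro exI[of _ "min \<delta> (t - s)"]) auto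
    ultimately have "integral {s..t} K - \<epsilon> * (t - 0 - s) \<le> H t - H s"
      by (intro tendsto_le[OF trivial_limit_at_right_real])
    moreover have "\<epsilon> * (t - 0 - s) = e"
      using \<open>s < t\<close> by (simp add: \<epsilon>_def)
    ultimately show ?thesis
      by simp
  qed
  then show ?thesis
    by (rule field_le_epsilon)
qed

text \<open>The reflection \<open>r \<mapsto> - r\<close> turns bounds on backward increments into
  bounds on forward ones.\<close>

lemma increment_le_integral:
  fixes H K :: "real \<Rightarrow> real"
  assumes "s < t" and H: "continuous_on {s..t} H" and K: "K integrable_on {s..t}"
    and inc: "\<And>\<epsilon>. \<epsilon> > 0 \<Longrightarrow> \<exists>\<delta>>0. \<forall>r h. s \<le> r - h \<and> 0 < h \<and> h < \<delta> \<and> r \<le> t \<longrightarrow>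
      H r - H (r - h) \<le> h * (K r + \<epsilon>)"
  shows "H t - H s \<le> integral {s..t} K"
proof -
  have "integral {- t..- s} (\<lambda>r. - K (- r)) \<le> H (- (- s)) - H (- (- t))"
  proof (rule integral_le_increment[where H = "\<lambda>r. H (- r)"])
    show "continuous_on {- t..- s} (\<lambda>r. H (- r))"
      by (intro continuous_on_compose2[OF H] continuous_intros) auto
    show "(\<lambda>r. - K (- r)) integrable_on {- t..- s}"
      using K by (intro integrable_neg) (simp add: integrable_reflect_real)
    fix \<epsilon> :: real assume "\<epsilon> > 0"
    from inc[OF this] obtain \<delta> where \<delta>: "\<delta> > 0"
      "\<And>r h. s \<le> r - h \<Longrightarrow> 0 < h \<Longrightarrow> h < \<delta> \<Longrightarrow> r \<le> t \<Longrightarrow> H r - H (r - h) \<le> h * (K r + \<epsilon>)"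
      by blast
    have "h * (- K (- r) - \<epsilon>) \<le> H (- (r + h)) - H (- r)"
      if "- t \<le> r \<and> 0 < h \<and> h < \<delta> \<and> r + h \<le> - s" for r h
    proof -
      have "- (r + h) = - r - h"
        by simp
      then show ?thesis
        using \<delta>(2)[of "- r" h] that by (simp add: right_diff_distrib distrib_left)
    qed
    with \<delta>(1) show "\<exists>\<delta>>0. \<forall>r h. - t \<le> r \<and> 0 < h \<and> h < \<delta> \<and> r + h \<le> - s \<longrightarrow>
      h * (- K (- r) - \<epsilon>) \<le> H (- (r + h)) - H (- r)"
      by blast
  qed (use \<open>s < t\<close> in simp)
  moreover have "integral {- t..- s} (\<lambda>r. - K (- r)) = - integral {s..t} K"
    using Henstock_Kurzweil_Integration.integral_reflect_real[of t s K] by simp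
  ultimately show ?thesis
    by simp
qed

text \<open>The mean value theorem together with uniform continuity of the derivative on a compact
  interval. Independence of \<open>\<delta>\<close> from the base point is essential, because the
  estimate is later integrated over base points.\<close>

lemma uniform_linear_approximation:
  fixes g g' :: "real \<Rightarrow> real"
  assumes deriv: "\<And>t. t \<in> {a..b} \<Longrightarrow> (g has_vector_derivative g' t) (at t within {a..b})"
    and cont: "continuous_on {a..b} g'" and "\<epsilon> > 0"
  shows "\<exists>\<delta>>0. \<forall>s\<in>{a..b}. \<forall>t\<in>{a..b}. \<bar>t - s\<bar> < \<delta> \<longrightarrow> \<bar>g t - g s - (t - s) * g' s\<bar> \<le> \<epsilon> * \<bar>t - s\<bar>"
proof -
  have "uniformly_continuous_on {a..b} g'"
    by (rule compact_uniformly_continuous[OF cont compact_Icc])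
  then obtain \<delta> where \<delta>: "\<delta> > 0" "\<And>s t. s \<in> {a..b} \<Longrightarrow> t \<in> {a..b} \<Longrightarrow> dist t s < \<delta> \<Longrightarrow> dist (g' t) (g' s) < \<epsilon>"
    unfolding uniformly_continuous_on_def using \<open>\<epsilon> > 0\<close> by metis
  have mvt: "\<exists>\<xi>. s \<le> \<xi> \<and> \<xi> \<le> t \<and> g t - g s = (t - s) * g' \<xi>" if "s \<in> {a..b}" "t \<in> {a..b}" "s < t" for s t
  proof -
    have "(g has_derivative (\<lambda>h. h * g' x)) (at x within {s..t})" if "s \<le> x" "x \<le> t" for x
      using has_vector_derivative_within_subset[OF deriv[of x], of "{s..t}"] that \<open>s \<in> {a..b}\<close> \<open>t \<in> {a..b}\<close>
      by (auto simp: has_vector_derivative_def)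
    then have "\<exists>\<xi>\<in>{s<..<t}. g t - g s = (t - s) * g' \<xi>"
      by (rule mvt_simple[OF \<open>s < t\<close>])
    then obtain \<xi> where "\<xi> \<in> {s<..<t}" "g t - g s = (t - s) * g' \<xi>"
      by blast
    then show ?thesis
      by (intro exI[of _ \<xi>]) auto
  qed
  have "\<bar>g t - g s - (t - s) * g' s\<bar> \<le> \<epsilon> * \<bar>t - s\<bar>"
    if st: "s \<in> {a..b}" "t \<in> {a..b}" and close: "\<bar>t - s\<bar> < \<delta>" for s t
  proof (cases "s = t")
    case False
    then obtain \<xi> where \<xi>: "\<bar>\<xi> - s\<bar> < \<delta>" "\<xi> \<in> {a..b}" "g t - g s = (t - s) * g' \<xi>"
    proof (cases "s < t")
      case True
      from mvt[OF st this] obtain \<xi> where \<xi>: "s \<le> \<xi>" "\<xi> \<le> t" "g t - g s = (t - s) * g' \<xi>"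
        by blast
      show thesis
        by (rule that[OF _ _ \<xi>(3)]) (use \<xi> close st in auto)
    next
      case False
      with \<open>s \<noteq> t\<close> have "t < s" by simp
      from mvt[OF st(2,1) this] obtain \<xi> where \<xi>: "t \<le> \<xi>" "\<xi> \<le> s" "g s - g t = (s - t) * g' \<xi>"
        by blast
      then have "g t - g s = (t - s) * g' \<xi>"
        by (simp add: algebra_simps)
      show thesis
        by (rule that[OF _ _ \<open>g t - g s = (t - s) * g' \<xi>\<close>]) (use \<xi> close st in auto)
    qed
    then have "g t - g s - (t - s) * g' s = (t - s) * (g' \<xi> - g' s)"
      by (simp add: algebra_simps)
    then have "\<bar>g t - g s - (t - s) * g' s\<bar> = \<bar>t - s\<bar> * \<bar>g' \<xi> - g' s\<bar>"
      by (simp add: abs_mult)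
    also have "\<dots> \<le> \<bar>t - s\<bar> * \<epsilon>"
      using \<delta>(2)[of s \<xi>] \<xi> st by (intro mult_left_mono) (auto simp: dist_real_def)
    finally show ?thesis
      by (simp add: mult.commute)
  qed simp
  with \<delta>(1) show ?thesis
    by blast
qed

text \<open>A class closed under the operations below whose members on an interval are both Lebesgue
  and gauge integrable: revenue is a Lebesgue integral, while the calculus uses the gauge integral.
  Measurability is required within \<open>T\<close> only, as for mechanisms.\<close>

definition bounded_measurable_on :: "real set \<Rightarrow> (real \<Rightarrow> real) \<Rightarrow> bool" where
  "bounded_measurable_on T g \<longleftrightarrow>
     g \<in> borel_measurable (restrict_space borel T) \<and> (\<exists>C. \<forall>t\<in>T. \<bar>g t\<bar> \<le> C)"

lemma bounded_measurable_onI: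
  "g \<in> borel_measurable (restrict_space borel T) \<Longrightarrow> (\<And>t. t \<in> T \<Longrightarrow> \<bar>g t\<bar> \<le> C) \<Longrightarrow> bounded_measurable_on T g"
  by (auto simp: bounded_measurable_on_def)

lemma bounded_measurable_on_cong:
  "(\<And>t. t \<in> T \<Longrightarrow> g t = h t) \<Longrightarrow> bounded_measurable_on T g \<longleftrightarrow> bounded_measurable_on T h"
  unfolding bounded_measurable_on_def
  by (intro conj_cong measurable_cong ex_cong ball_cong) (auto simp: space_restrict_space)

lemma bounded_measurable_on_continuous:
  assumes "continuous_on {a..b} g"
  shows "bounded_measurable_on {a..b} g"
proof -
  have "bounded (g ` {a..b})"
    using compact_continuous_image[OF assms compact_Icc] by (rule compact_imp_bounded)
  then show ?thesis
    unfolding bounded_measurable_on_def bounded_iff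
    using borel_measurable_continuous_on_restrict[OF assms] by auto
qed

lemma bounded_measurable_on_mult:
  assumes "bounded_measurable_on T g" "bounded_measurable_on T h"
  shows "bounded_measurable_on T (\<lambda>t. g t * h t)"
proof -
  obtain C D where "\<forall>t\<in>T. \<bar>g t\<bar> \<le> C" "\<forall>t\<in>T. \<bar>h t\<bar> \<le> D"
    using assms by (auto simp: bounded_measurable_on_def)
  then have "\<forall>t\<in>T. \<bar>g t * h t\<bar> \<le> C * D"
    by (auto simp: abs_mult intro!: mult_mono intro: order_trans[OF abs_ge_zero])
  with assms show ?thesis
    by (auto simp: bounded_measurable_on_def)
qed

lemma bounded_measurable_on_add:
  assumes "bounded_measurable_on T g" "bounded_measurable_on T h"
  shows "bounded_measurable_on T (\<lambda>t. g t + h t)"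
proof -
  obtain C D where "\<forall>t\<in>T. \<bar>g t\<bar> \<le> C" "\<forall>t\<in>T. \<bar>h t\<bar> \<le> D"
    using assms by (auto simp: bounded_measurable_on_def)
  then have "\<forall>t\<in>T. \<bar>g t + h t\<bar> \<le> C + D"
    by (auto intro: order_trans[OF abs_triangle_ineq] add_mono)
  with assms show ?thesis
    by (auto simp: bounded_measurable_on_def)
qed

lemma bounded_measurable_on_diff:
  assumes "bounded_measurable_on T g" "bounded_measurable_on T h"
  shows "bounded_measurable_on T (\<lambda>t. g t - h t)"
proof -
  obtain C D where "\<forall>t\<in>T. \<bar>g t\<bar> \<le> C" "\<forall>t\<in>T. \<bar>h t\<bar> \<le> D"
    using assms by (auto simp: bounded_measurable_on_def)
  then have "\<forall>t\<in>T. \<bar>g t - h t\<bar> \<le> C + D"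
    by (auto intro: order_trans[OF abs_triangle_ineq4] add_mono)
  with assms show ?thesis
    by (auto simp: bounded_measurable_on_def)
qed

lemma bounded_measurable_on_sum:
  "(\<And>i. i \<in> I \<Longrightarrow> bounded_measurable_on T (g i)) \<Longrightarrow> bounded_measurable_on T (\<lambda>t. \<Sum>i\<in>I. g i t)"
  by (induction I rule: infinite_finite_induct)
     (auto intro: bounded_measurable_on_add bounded_measurable_onI[of _ _ 0])

lemma bounded_measurable_on_set_integrable:
  assumes "bounded_measurable_on {a..b} g"
  shows "set_integrable lborel {a..b} g"
proof -
  obtain C where g: "g \<in> borel_measurable (restrict_space borel {a..b})" and C: "\<And>t. t \<in> {a..b} \<Longrightarrow> \<bar>g t\<bar> \<le> C"
    using assms unfolding bounded_measurable_on_def by blast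
  have meas: "(\<lambda>t. indicator {a..b} t *\<^sub>R g t) \<in> borel_measurable lborel"
    using g by (simp add: borel_measurable_restrict_space_iff)
  have "integrable lborel (\<lambda>t. indicator {a..b} t *\<^sub>R C)"
    by (intro integrable_scaleR_left integrable_real_indicator) (auto simp: emeasure_lborel_Icc_eq)
  then have "integrable lborel (\<lambda>t. indicator {a..b} t *\<^sub>R g t)"
    by (rule Bochner_Integration.integrable_bound[OF _ meas])
       (use C in \<open>auto simp: indicator_def intro: order_trans[OF _ abs_ge_self]\<close>)
  then show ?thesis
    by (simp add: set_integrable_def)
qed

lemma bounded_measurable_on_integrable_on:
  assumes "bounded_measurable_on {a..b} g"
  shows "g integrable_on {a..b}"
  by (rule set_borel_integral_eq_integral(1)[OF bounded_measurable_on_set_integrable[OF assms]])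

lemma has_vector_derivative_nonneg_mono_on:
  fixes g :: "real \<Rightarrow> real"
  assumes "mono_on {a..b} g" "a < b" "t \<in> {a..b}" "(g has_vector_derivative D) (at t within {a..b})"
  shows "0 \<le> D"
proof -
  have lim: "((\<lambda>y. (g y - g t) / (y - t)) \<longlongrightarrow> D) (at t within {a..b})"
    using assms(4) by (simp add: has_field_derivative_iff flip: has_real_derivative_iff_has_vector_derivative)
  have nontriv: "at t within {a..b} \<noteq> bot"
    using assms(2,3) by (simp add: trivial_limit_within islimpt_Icc)
  have ev: "\<forall>\<^sub>F y in at t within {a..b}. 0 \<le> (g y - g t) / (y - t)"
    unfolding eventually_at_filter
  proof (intro always_eventually allI impI)
    fix y assume "y \<noteq> t" "y \<in> {a..b}"
    then show "0 \<le> (g y - g t) / (y - t)"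
      using assms(1,3) by (cases "y < t") (auto simp: monotone_on_def intro!: divide_nonneg_nonneg divide_nonpos_nonpos)
  qed
  show ?thesis
    by (rule tendsto_lowerbound[OF lim ev nontriv])
qed

section \<open>Revenue and virtual surplus\<close>

locale screening =
  fixes t0 t1 :: real
    and f :: "real \<Rightarrow> real"
    and v :: "'g::finite set pmf \<Rightarrow> real \<Rightarrow> real"
  assumes t0_less_t1: "t0 < t1"
    and f_continuous: "continuous_on {t0..t1} f"
    and f_pos: "\<forall>t\<in>{t0..t1}. f t > 0"
    and prob_type_distr: "prob_space (type_distr t0 t1 f)"
    and v_differentiable: "\<forall>a. continuously_differentiable_on {t0..t1} (v a)"
    and v_expectation: "\<forall>a. \<forall>t\<in>{t0..t1}. v a t = measure_pmf.expectation a (\<lambda>b. v (return_pmf b) t)"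
begin

abbreviation val :: "'g set \<Rightarrow> real \<Rightarrow> real" where
  "val b \<equiv> v (return_pmf b)"

definition slope :: "'g set \<Rightarrow> real \<Rightarrow> real" where
  "slope b t = vector_derivative (val b) (at t within {t0..t1})"

definition survival :: "real \<Rightarrow> real" where
  "survival t = 1 - cdf (type_distr t0 t1 f) t"

abbreviation virtual :: "'g set \<Rightarrow> real \<Rightarrow> real" where
  "virtual \<equiv> virtual_value_bundle t0 t1 f v"

lemma endpoints: "t0 \<in> {t0..t1}" "t1 \<in> {t0..t1}"
  using t0_less_t1 by auto

lemma virtual_eq: "virtual b t = val b t - survival t / f t * slope b t"
  by (simp add: virtual_value_bundle_def survival_def slope_def)

lemma val_derivative: "t \<in> {t0..t1} \<Longrightarrow> (val b has_vector_derivative slope b t) (at t within {t0..t1})"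
  and slope_continuous: "continuous_on {t0..t1} (slope b)"
proof -
  obtain d where d: "\<And>t. t \<in> {t0..t1} \<Longrightarrow> (val b has_vector_derivative d t) (at t within {t0..t1})"
    "continuous_on {t0..t1} d"
    using v_differentiable unfolding continuously_differentiable_on_def by meson
  have slope: "slope b t = d t" if "t \<in> {t0..t1}" for t
    unfolding slope_def by (rule vector_derivative_within_closed_interval[OF t0_less_t1 that d(1)[OF that]])
  then show "t \<in> {t0..t1} \<Longrightarrow> (val b has_vector_derivative slope b t) (at t within {t0..t1})"
    using d(1) by simp
  show "continuous_on {t0..t1} (slope b)"
    by (subst continuous_on_cong[OF refl slope]) (use d(2) in auto)
qed

lemma val_continuous: "continuous_on {t0..t1} (val b)"
  using val_derivative has_vector_derivative_continuous continuous_on_eq_continuous_within by blast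

lemma expectation_eq_sum:
  fixes g :: "'g set \<Rightarrow> real"
  shows "measure_pmf.expectation a g = (\<Sum>b\<in>UNIV. pmf a b * g b)"
  by (subst integral_measure_pmf[of UNIV]) simp_all

lemma v_eq_sum: "t \<in> {t0..t1} \<Longrightarrow> v a t = (\<Sum>b\<in>UNIV. pmf a b * val b t)"
  using v_expectation[rule_format, of t a] by (simp only: expectation_eq_sum)

lemma virtual_value_eq_sum: "virtual_value t0 t1 f v a t = (\<Sum>b\<in>UNIV. pmf a b * virtual b t)"
  by (simp add: virtual_value_def expectation_eq_sum)

lemma virtual_value_return: "virtual_value t0 t1 f v (return_pmf b) t = virtual b t"
  by (simp add: virtual_value_def)

section \<open>The type distribution and its survival function\<close>

lemma density_measurable: "(\<lambda>t. indicator {t0..t1} t * f t) \<in> borel_measurable lborel"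
  using borel_measurable_continuous_on_indicator[OF _ f_continuous] by simp

lemma integral_type_distr:
  assumes "g \<in> borel_measurable lborel"
  shows "(LINT t|type_distr t0 t1 f. g t) = (LINT t:{t0..t1}|lborel. f t * g t)"
  unfolding type_distr_def set_lebesgue_integral_def
  using f_pos
  by (subst integral_density[OF assms density_measurable])
     (auto intro!: AE_I2 simp: indicator_def mult.assoc less_imp_le split: if_splits)

lemma continuous_set_integral:
  assumes "a \<in> {t0..t1}" "b \<in> {t0..t1}"
  shows "(LINT t:{a..b}|lborel. f t) = integral {a..b} f"
  by (intro set_borel_integral_eq_integral(2) bounded_measurable_on_set_integrable
        bounded_measurable_on_continuous continuous_on_subset[OF f_continuous]) (use assms in auto)

lemma survival_eq:
  assumes "t \<in> {t0..t1}"
  shows "survival t = 1 - integral {t0..t} f"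
proof -
  interpret prob_space "type_distr t0 t1 f"
    by (rule prob_type_distr)
  have "cdf (type_distr t0 t1 f) t = (LINT s|type_distr t0 t1 f. indicator {..t} s)"
    by (simp add: cdf_def type_distr_def)
  also have "\<dots> = (LINT s:{t0..t1}|lborel. f s * indicator {..t} s)"
    by (rule integral_type_distr) simp
  also have "\<dots> = (LINT s:{t0..t}|lborel. f s)"
    unfolding set_lebesgue_integral_def
    using assms by (intro Bochner_Integration.integral_cong) (auto simp: indicator_def)
  also have "\<dots> = integral {t0..t} f"
    using assms endpoints by (intro continuous_set_integral)
  finally show ?thesis
    by (simp add: survival_def)
qed

lemma integral_density_eq_1: "integral {t0..t1} f = 1"
proof -
  interpret prob_space "type_distr t0 t1 f"
    by (rule prob_type_distr)
  have "(1::real) = (LINT s|type_distr t0 t1 f. 1)"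
    using prob_space by simp
  also have "\<dots> = integral {t0..t1} f"
    using integral_type_distr[of "\<lambda>_. 1"] continuous_set_integral[OF endpoints] by simp
  finally show ?thesis
    by simp
qed

lemma survival_t0: "survival t0 = 1" and survival_t1: "survival t1 = 0"
  using survival_eq[OF endpoints(1)] survival_eq[OF endpoints(2)] integral_density_eq_1 by simp_all

lemma survival_bounds:
  assumes "t \<in> {t0..t1}"
  shows "0 \<le> survival t" "survival t \<le> 1"
proof -
  interpret prob_space "type_distr t0 t1 f"
    by (rule prob_type_distr)
  show "0 \<le> survival t" "survival t \<le> 1"
    by (auto simp: survival_def cdf_def)
qed

lemma survival_derivative:
  assumes "t \<in> {t0..t1}"
  shows "(survival has_vector_derivative - f t) (at t within {t0..t1})"
proof -
  have "((\<lambda>t. 1 - integral {t0..t} f) has_vector_derivative 0 - f t) (at t within {t0..t1})"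
    by (intro has_vector_derivative_diff has_vector_derivative_const
        integral_has_vector_derivative[OF f_continuous assms])
  then show ?thesis
    using has_vector_derivative_transform[OF assms survival_eq] by simp
qed

lemma survival_continuous: "continuous_on {t0..t1} survival"
  using survival_derivative has_vector_derivative_continuous continuous_on_eq_continuous_within by blast

lemma virtual_continuous: "continuous_on {t0..t1} (virtual b)"
  unfolding virtual_eq
  using f_pos
  by (intro continuous_intros val_continuous survival_continuous slope_continuous f_continuous) force

lemma revenue_eq:
  assumes "bounded_measurable_on {t0..t1} p"
  shows "revenue t0 t1 f p = integral {t0..t1} (\<lambda>t. f t * p t)"
proof -
  have "(\<lambda>t. indicator {t0..t1} t *\<^sub>R p t) \<in> borel_measurable lborel"
    using assms by (simp add: bounded_measurable_on_def borel_measurable_restrict_space_iff)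
  then have "revenue t0 t1 f p = (LINT t:{t0..t1}|lborel. f t * (indicator {t0..t1} t *\<^sub>R p t))"
    unfolding revenue_def set_lebesgue_integral_def[of "type_distr t0 t1 f"] by (rule integral_type_distr)
  also have "\<dots> = (LINT t:{t0..t1}|lborel. f t * p t)"
    by (intro set_lebesgue_integral_cong) auto
  also have "\<dots> = integral {t0..t1} (\<lambda>t. f t * p t)"
    by (intro set_borel_integral_eq_integral(2) bounded_measurable_on_set_integrable
        bounded_measurable_on_mult bounded_measurable_on_continuous f_continuous assms)
  finally show ?thesis .
qed

section \<open>Mechanisms, lotteries and the revenue formula\<close>

lemma mechanism_measurable:
  assumes "mechanism t0 t1 a p"
  shows "(\<lambda>t. pmf (a t) b) \<in> borel_measurable (restrict_space borel {t0..t1})"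
    and "p \<in> borel_measurable (restrict_space borel {t0..t1})"
proof -
  note m = assms[unfolded mechanism_def]
  have "(\<lambda>t. measure_pmf (a t)) \<in> restrict_space borel {t0..t1} \<rightarrow>\<^sub>M prob_algebra (count_space UNIV)"
    using measurable_compose[OF m measurable_fst] by simp
  from measurable_compose[OF this measurable_measure_prob_algebra[of "{b}"]]
  show "(\<lambda>t. pmf (a t) b) \<in> borel_measurable (restrict_space borel {t0..t1})"
    by (simp add: pmf.rep_eq)
  show "p \<in> borel_measurable (restrict_space borel {t0..t1})"
    using measurable_compose[OF m measurable_snd] by simp
qed

lemma mechanism_bounded_measurable_mix:
  assumes "mechanism t0 t1 a p" "\<And>b. continuous_on {t0..t1} (g b)"
  shows "bounded_measurable_on {t0..t1} (\<lambda>t. \<Sum>b\<in>UNIV. pmf (a t) b * g b t)"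
  by (intro bounded_measurable_on_sum bounded_measurable_on_mult
        bounded_measurable_onI[where C = 1, OF mechanism_measurable(1)[OF assms(1)]]
        bounded_measurable_on_continuous assms(2)) (simp add: pmf_le_1)

text \<open>A lottery averages finitely many bundles, so the smallest of their radii serves all
  lotteries at once. This permits the choice \<open>c = a s\<close>, which varies with the base
  point.\<close>

lemma lottery_linear_approximation:
  assumes "\<epsilon> > 0"
  shows "\<exists>\<delta>>0. \<forall>c. \<forall>s\<in>{t0..t1}. \<forall>t\<in>{t0..t1}. \<bar>t - s\<bar> < \<delta> \<longrightarrow>
    \<bar>v c t - v c s - (t - s) * (\<Sum>b\<in>UNIV. pmf c b * slope b s)\<bar> \<le> \<epsilon> * \<bar>t - s\<bar>"
proof -
  have "\<exists>\<delta>. \<delta> > 0 \<and> (\<forall>s\<in>{t0..t1}. \<forall>t\<in>{t0..t1}. \<bar>t - s\<bar> < \<delta> \<longrightarrow>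
      \<bar>val b t - val b s - (t - s) * slope b s\<bar> \<le> \<epsilon> * \<bar>t - s\<bar>)" for b
    using uniform_linear_approximation[OF val_derivative slope_continuous assms, of b] by blast
  then obtain d where d: "\<And>b. d b > 0" "\<And>b s t. s \<in> {t0..t1} \<Longrightarrow> t \<in> {t0..t1} \<Longrightarrow> \<bar>t - s\<bar> < d b \<Longrightarrow>
      \<bar>val b t - val b s - (t - s) * slope b s\<bar> \<le> \<epsilon> * \<bar>t - s\<bar>"
    by metis
  have "\<bar>v c t - v c s - (t - s) * (\<Sum>b\<in>UNIV. pmf c b * slope b s)\<bar> \<le> \<epsilon> * \<bar>t - s\<bar>"
    if st: "s \<in> {t0..t1}" "t \<in> {t0..t1}" and close: "\<bar>t - s\<bar> < Min (range d)" for c s t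
  proof -
    have "v c t - v c s - (t - s) * (\<Sum>b\<in>UNIV. pmf c b * slope b s)
        = (\<Sum>b\<in>UNIV. pmf c b * (val b t - val b s - (t - s) * slope b s))"
      unfolding v_eq_sum[OF st(1), of c] v_eq_sum[OF st(2), of c]
      by (simp add: sum_distrib_left right_diff_distrib sum_subtractf mult.left_commute)
    also have "\<bar>\<dots>\<bar> \<le> (\<Sum>b\<in>UNIV. pmf c b * (\<epsilon> * \<bar>t - s\<bar>))"
    proof (intro order_trans[OF sum_abs] sum_mono)
      fix b
      have "\<bar>t - s\<bar> < d b"
        using close by simp
      from d(2)[OF st this]
      show "\<bar>pmf c b * (val b t - val b s - (t - s) * slope b s)\<bar> \<le> pmf c b * (\<epsilon> * \<bar>t - s\<bar>)"
        by (simp add: abs_mult mult_left_mono)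
    qed
    also have "\<dots> = \<epsilon> * \<bar>t - s\<bar>"
      using sum_pmf_eq_1[of UNIV c] by (simp flip: sum_distrib_right)
    finally show ?thesis .
  qed
  moreover have "Min (range d) > 0"
    using d(1) by simp
  ultimately show ?thesis
    by blast
qed

text \<open>
  Incentive compatibility says that the lottery of type \<open>s\<close> supports the utility function \<open>u\<close> at \<open>s\<close>.
  The product of \<open>u\<close> and the survival function therefore grows at least like its formal derivative,
  to the left and to the right, which replaces the envelope theorem and integration by parts.
\<close>

lemma revenue_virtual_surplus:
  assumes mech: "mechanism t0 t1 a p" and IC: "IC t0 t1 v a p"
  shows "bounded_measurable_on {t0..t1} p"
    and "revenue t0 t1 f p
      = integral {t0..t1} (\<lambda>t. f t * virtual_value t0 t1 f v (a t) t) - (v (a t0) t0 - p t0)"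
proof -
  define u where "u = (\<lambda>t. v (a t) t - p t)"
  define D where "D = (\<lambda>t. \<Sum>b\<in>UNIV. pmf (a t) b * slope b t)"
  have D_bm: "bounded_measurable_on {t0..t1} D"
    unfolding D_def by (rule mechanism_bounded_measurable_mix[OF mech slope_continuous])
  have supp: "\<exists>\<delta>>0. \<forall>s\<in>{t0..t1}. \<forall>t\<in>{t0..t1}. \<bar>t - s\<bar> < \<delta> \<longrightarrow> (t - s) * D s - \<epsilon> * \<bar>t - s\<bar> \<le> u t - u s"
    if \<epsilon>: "\<epsilon> > 0" for \<epsilon>
  proof -
    obtain \<delta> where \<delta>: "\<delta> > 0" "\<And>c s t. s \<in> {t0..t1} \<Longrightarrow> t \<in> {t0..t1} \<Longrightarrow> \<bar>t - s\<bar> < \<delta> \<Longrightarrow>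
        \<bar>v c t - v c s - (t - s) * (\<Sum>b\<in>UNIV. pmf c b * slope b s)\<bar> \<le> \<epsilon> * \<bar>t - s\<bar>"
      using lottery_linear_approximation[OF \<epsilon>] by blast
    have "(t - s) * D s - \<epsilon> * \<bar>t - s\<bar> \<le> u t - u s"
      if st: "s \<in> {t0..t1}" "t \<in> {t0..t1}" "\<bar>t - s\<bar> < \<delta>" for s t
    proof -
      have "v (a s) t - v (a s) s \<le> u t - u s"
        using IC st unfolding IC_def u_def by force
      moreover have "(t - s) * D s - \<epsilon> * \<bar>t - s\<bar> \<le> v (a s) t - v (a s) s"
        using \<delta>(2)[OF st, of "a s"] unfolding D_def by linarith
      ultimately show ?thesis
        by simp
    qed
    with \<delta>(1) show ?thesis
      by blast
  qed
  \<comment> \<open>Exchanging the two types in \<open>supp\<close> bounds increments of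
    \<open>u\<close> from both sides, which makes \<open>u\<close> locally Lipschitz; boundedness of
    \<open>p\<close> is then obtained from that of \<open>u\<close>.\<close>
  have u_cont: "continuous_on {t0..t1} u"
    unfolding continuous_on_iff
  proof (intro ballI allI impI)
    fix s e :: real assume s: "s \<in> {t0..t1}" and e: "e > 0"
    obtain M where M: "\<And>t. t \<in> {t0..t1} \<Longrightarrow> \<bar>D t\<bar> \<le> M"
      using D_bm unfolding bounded_measurable_on_def by blast
    then have "0 \<le> M"
      using s by fastforce
    obtain \<delta> where \<delta>: "\<delta> > 0" "\<And>s t. s \<in> {t0..t1} \<Longrightarrow> t \<in> {t0..t1} \<Longrightarrow> \<bar>t - s\<bar> < \<delta> \<Longrightarrow>
        (t - s) * D s - 1 * \<bar>t - s\<bar> \<le> u t - u s"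
      using supp[of 1] by auto
    have lower: "- ((M + 1) * \<bar>t - s\<bar>) \<le> u t - u s"
      if st: "s \<in> {t0..t1}" "t \<in> {t0..t1}" "\<bar>t - s\<bar> < \<delta>" for s t
    proof -
      have "\<bar>(t - s) * D s\<bar> \<le> M * \<bar>t - s\<bar>"
        using M[OF st(1)] by (simp add: abs_mult mult.commute mult_right_mono)
      moreover have "- ((M + 1) * \<bar>t - s\<bar>) = - (M * \<bar>t - s\<bar>) - 1 * \<bar>t - s\<bar>"
        by (simp add: algebra_simps)
      moreover note \<delta>(2)[OF st]
      ultimately show ?thesis
        by linarith
    qed
    have "dist (u t) (u s) < e" if t: "t \<in> {t0..t1}" "dist t s < min \<delta> (e / (M + 1))" for t
    proof -
      have close: "\<bar>t - s\<bar> < \<delta>" "\<bar>s - t\<bar> < \<delta>"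
        using t(2) by (auto simp: dist_real_def)
      have "\<bar>u t - u s\<bar> \<le> (M + 1) * \<bar>t - s\<bar>"
        using lower[OF s t(1) close(1)] lower[OF t(1) s close(2)] unfolding abs_minus_commute[of s t] by linarith
      also have "\<dots> < e"
        using t(2) \<open>0 \<le> M\<close> by (simp add: dist_real_def field_simps)
      finally show ?thesis
        by (simp add: dist_real_def)
    qed
    moreover have "min \<delta> (e / (M + 1)) > 0"
      using \<delta>(1) e \<open>0 \<le> M\<close> by simp
    ultimately show "\<exists>d>0. \<forall>t\<in>{t0..t1}. dist t s < d \<longrightarrow> dist (u t) (u s) < e"
      by blast
  qed
  have u_bm: "bounded_measurable_on {t0..t1} u"
    by (rule bounded_measurable_on_continuous[OF u_cont])
  have v_bm: "bounded_measurable_on {t0..t1} (\<lambda>t. v (a t) t)"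
    using mechanism_bounded_measurable_mix[OF mech val_continuous]
    by (subst bounded_measurable_on_cong[OF v_eq_sum])
  show p_bm: "bounded_measurable_on {t0..t1} p"
    using bounded_measurable_on_diff[OF v_bm u_bm] by (simp add: u_def)

  \<comment> \<open>\<open>K\<close> is the product rule applied formally to \<open>H\<close>, with
    \<open>D\<close> for the derivative of \<open>u\<close>. As \<open>survival\<close> falls from 1
    to 0, the increment of \<open>H\<close> is minus the utility of the lowest type.\<close>
  define H where "H = (\<lambda>t. u t * survival t)"
  define K where "K = (\<lambda>t. D t * survival t - u t * f t)"
  have H_cont: "continuous_on {t0..t1} H"
    unfolding H_def by (intro continuous_intros u_cont survival_continuous)
  have K_bm: "bounded_measurable_on {t0..t1} K"
    unfolding K_def
    by (intro bounded_measurable_on_diff bounded_measurable_on_mult D_bm u_bm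
        bounded_measurable_on_continuous survival_continuous f_continuous)
  have H_supp: "\<exists>\<delta>>0. \<forall>s\<in>{t0..t1}. \<forall>t\<in>{t0..t1}. \<bar>t - s\<bar> < \<delta> \<longrightarrow> (t - s) * K s - \<epsilon> * \<bar>t - s\<bar> \<le> H t - H s"
    if \<epsilon>: "\<epsilon> > 0" for \<epsilon>
  proof -
    obtain U where U: "\<And>t. t \<in> {t0..t1} \<Longrightarrow> \<bar>u t\<bar> \<le> U"
      using u_bm unfolding bounded_measurable_on_def by blast
    obtain L where L: "\<And>t. t \<in> {t0..t1} \<Longrightarrow> \<bar>f t\<bar> \<le> L"
      using bounded_measurable_on_continuous[OF f_continuous] unfolding bounded_measurable_on_def by blast
    have nonneg: "0 \<le> U" "0 \<le> L"
      using U[OF endpoints(1)] L[OF endpoints(1)] by auto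
    \<comment> \<open>The three error terms below are bounded by \<open>e\<close>,
      \<open>L * e\<close> and \<open>U * e\<close> times the distance of the types.\<close>
    define e where "e = \<epsilon> / (1 + L + U)"
    have "e > 0"
      using \<epsilon> nonneg by (simp add: e_def)
    obtain \<delta>1 where \<delta>1: "\<delta>1 > 0" "\<And>s t. s \<in> {t0..t1} \<Longrightarrow> t \<in> {t0..t1} \<Longrightarrow> \<bar>t - s\<bar> < \<delta>1 \<Longrightarrow>
        (t - s) * D s - e * \<bar>t - s\<bar> \<le> u t - u s"
      using supp[OF \<open>e > 0\<close>] by blast
    obtain \<delta>2 where \<delta>2: "\<delta>2 > 0" "\<And>s t. s \<in> {t0..t1} \<Longrightarrow> t \<in> {t0..t1} \<Longrightarrow> \<bar>t - s\<bar> < \<delta>2 \<Longrightarrow>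
        \<bar>survival t - survival s - (t - s) * (- f s)\<bar> \<le> e * \<bar>t - s\<bar>"
      using uniform_linear_approximation[OF survival_derivative _ \<open>e > 0\<close>] continuous_on_minus[OF f_continuous]
      by blast
    have "uniformly_continuous_on {t0..t1} u"
      by (rule compact_uniformly_continuous[OF u_cont compact_Icc])
    then obtain \<delta>3 where \<delta>3: "\<delta>3 > 0" "\<And>s t. s \<in> {t0..t1} \<Longrightarrow> t \<in> {t0..t1} \<Longrightarrow> \<bar>t - s\<bar> < \<delta>3 \<Longrightarrow> \<bar>u t - u s\<bar> < e"
      unfolding uniformly_continuous_on_def dist_real_def using \<open>e > 0\<close> by metis
    have "(t - s) * K s - \<epsilon> * \<bar>t - s\<bar> \<le> H t - H s"
      if st: "s \<in> {t0..t1}" "t \<in> {t0..t1}" and close: "\<bar>t - s\<bar> < min \<delta>1 (min \<delta>2 \<delta>3)" for s t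
    proof -
      define r where "r = survival t - survival s - (t - s) * (- f s)"
      have c: "\<bar>t - s\<bar> < \<delta>1" "\<bar>t - s\<bar> < \<delta>2" "\<bar>t - s\<bar> < \<delta>3"
        using close by auto
      have 1: "((t - s) * D s - e * \<bar>t - s\<bar>) * survival s \<le> (u t - u s) * survival s"
        using \<delta>1(2)[OF st c(1)] survival_bounds(1)[OF st(1)] by (rule mult_right_mono)
      have 2: "e * \<bar>t - s\<bar> * survival s \<le> e * \<bar>t - s\<bar>"
        using survival_bounds(2)[OF st(1)] \<open>e > 0\<close> by (simp add: mult_left_le)
      have "\<bar>(t - s) * (u t - u s) * f s\<bar> \<le> \<bar>t - s\<bar> * e * L"
        unfolding abs_mult
        using \<delta>3(2)[OF st c(3)] L[OF st(1)] \<open>e > 0\<close> by (intro mult_mono) auto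
      then have 3: "(t - s) * (u t - u s) * f s \<le> \<bar>t - s\<bar> * e * L"
        by linarith
      have "\<bar>u t * r\<bar> \<le> U * (e * \<bar>t - s\<bar>)"
        unfolding abs_mult r_def
        using \<delta>2(2)[OF st c(2)] U[OF st(2)] nonneg by (intro mult_mono) auto
      then have 4: "- (U * (e * \<bar>t - s\<bar>)) \<le> u t * r"
        by linarith
      have "\<epsilon> * \<bar>t - s\<bar> = e * \<bar>t - s\<bar> + \<bar>t - s\<bar> * e * L + U * (e * \<bar>t - s\<bar>)"
      proof -
        have "\<epsilon> = e * (1 + L + U)"
          using nonneg by (simp add: e_def)
        then show ?thesis
          by (simp add: algebra_simps)
      qed
      \<comment> \<open>The first order terms, then the mixed second order term, then the remainder
        \<open>r\<close> of \<open>survival\<close>.\<close>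
      moreover have "H t - H s = (u t - u s) * survival s - (t - s) * (u s * f s)
          - (t - s) * (u t - u s) * f s + u t * r"
        unfolding H_def r_def by (simp add: algebra_simps)
      moreover have "(t - s) * K s = (t - s) * D s * survival s - (t - s) * (u s * f s)"
        unfolding K_def by (simp add: algebra_simps)
      moreover have "((t - s) * D s - e * \<bar>t - s\<bar>) * survival s
          = (t - s) * D s * survival s - e * \<bar>t - s\<bar> * survival s"
        by (rule left_diff_distrib)
      ultimately show ?thesis
        using 1 2 3 4 by linarith
    qed
    moreover have "min \<delta>1 (min \<delta>2 \<delta>3) > 0"
      using \<delta>1(1) \<delta>2(1) \<delta>3(1) by simp
    ultimately show ?thesis
      by blast
  qed
  have "integral {t0..t1} K \<le> H t1 - H t0"
  proof (rule integral_le_increment[OF t0_less_t1 H_cont bounded_measurable_on_integrable_on[OF K_bm]])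
    fix \<epsilon> :: real assume "\<epsilon> > 0"
    from H_supp[OF this] obtain \<delta> where \<delta>: "\<delta> > 0" "\<And>s t. s \<in> {t0..t1} \<Longrightarrow> t \<in> {t0..t1} \<Longrightarrow> \<bar>t - s\<bar> < \<delta> \<Longrightarrow>
        (t - s) * K s - \<epsilon> * \<bar>t - s\<bar> \<le> H t - H s"
      by blast
    have "h * (K r - \<epsilon>) \<le> H (r + h) - H r" if "t0 \<le> r \<and> 0 < h \<and> h < \<delta> \<and> r + h \<le> t1" for r h
      using \<delta>(2)[of r "r + h"] that by (simp add: right_diff_distrib mult.commute)
    with \<delta>(1) show "\<exists>\<delta>>0. \<forall>r h. t0 \<le> r \<and> 0 < h \<and> h < \<delta> \<and> r + h \<le> t1 \<longrightarrow> h * (K r - \<epsilon>) \<le> H (r + h) - H r"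
      by blast
  qed
  moreover have "H t1 - H t0 \<le> integral {t0..t1} K"
  proof (rule increment_le_integral[OF t0_less_t1 H_cont bounded_measurable_on_integrable_on[OF K_bm]])
    fix \<epsilon> :: real assume "\<epsilon> > 0"
    from H_supp[OF this] obtain \<delta> where \<delta>: "\<delta> > 0" "\<And>s t. s \<in> {t0..t1} \<Longrightarrow> t \<in> {t0..t1} \<Longrightarrow> \<bar>t - s\<bar> < \<delta> \<Longrightarrow>
        (t - s) * K s - \<epsilon> * \<bar>t - s\<bar> \<le> H t - H s"
      by blast
    have "H r - H (r - h) \<le> h * (K r + \<epsilon>)" if "t0 \<le> r - h \<and> 0 < h \<and> h < \<delta> \<and> r \<le> t1" for r h
      using \<delta>(2)[of r "r - h"] that by (simp add: distrib_left mult.commute)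
    with \<delta>(1) show "\<exists>\<delta>>0. \<forall>r h. t0 \<le> r - h \<and> 0 < h \<and> h < \<delta> \<and> r \<le> t1 \<longrightarrow> H r - H (r - h) \<le> h * (K r + \<epsilon>)"
      by blast
  qed
  ultimately have int_K: "integral {t0..t1} K = - u t0"
    by (simp add: H_def survival_t0 survival_t1)
  have vv_bm: "bounded_measurable_on {t0..t1} (\<lambda>t. virtual_value t0 t1 f v (a t) t)"
    unfolding virtual_value_eq_sum by (rule mechanism_bounded_measurable_mix[OF mech virtual_continuous])
  \<comment> \<open>Price is value minus utility, and \<open>D * survival\<close> is exactly what
    separates \<open>f\<close> times the value from \<open>f\<close> times the virtual
    value.\<close>
  have split: "f t * p t = f t * virtual_value t0 t1 f v (a t) t + K t" if t: "t \<in> {t0..t1}" for t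
  proof -
    have "virtual_value t0 t1 f v (a t) t = v (a t) t - survival t / f t * D t"
      unfolding virtual_value_eq_sum virtual_eq D_def v_eq_sum[OF t, of "a t"]
      by (simp add: right_diff_distrib sum_subtractf sum_distrib_left mult.left_commute)
    moreover have "f t \<noteq> 0"
      using f_pos t by force
    ultimately show ?thesis
      unfolding K_def u_def by (simp add: field_simps)
  qed
  have "revenue t0 t1 f p = integral {t0..t1} (\<lambda>t. f t * virtual_value t0 t1 f v (a t) t + K t)"
    unfolding revenue_eq[OF p_bm] by (rule Henstock_Kurzweil_Integration.integral_cong[OF split])
  also have "\<dots> = integral {t0..t1} (\<lambda>t. f t * virtual_value t0 t1 f v (a t) t) + integral {t0..t1} K"
    by (intro Henstock_Kurzweil_Integration.integral_add bounded_measurable_on_integrable_on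
        bounded_measurable_on_mult bounded_measurable_on_continuous f_continuous vv_bm K_bm)
  finally show "revenue t0 t1 f p
      = integral {t0..t1} (\<lambda>t. f t * virtual_value t0 t1 f v (a t) t) - (v (a t0) t0 - p t0)"
    by (simp add: int_K u_def)
qed

section \<open>Prices that implement a monotone selection\<close>

lemma integral_slope:
  assumes "s \<in> {t0..t1}" "t \<in> {t0..t1}" "s \<le> t"
  shows "(slope b has_integral val b t - val b s) {s..t}"
proof (rule fundamental_theorem_of_calculus[OF assms(3)])
  fix r assume "r \<in> {s..t}"
  then show "(val b has_vector_derivative slope b r) (at r within {s..t})"
    using assms by (intro has_vector_derivative_within_subset[OF val_derivative]) auto
qed

text \<open>The price leaves each type the integral of the slopes of the bundles chosen by lower
  types, as the envelope formula demands. A deviation replaces these slopes, between the true and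
  the reported type, by those of one fixed bundle; the ordering of slopes makes this unprofitable in
  both directions. Participation follows by imitating the lowest type, whose bundle is worth 0 to
  everyone and costs 0.\<close>

lemma monotone_selection_feasible:
  assumes meas: "b \<in> restrict_space borel {t0..t1} \<rightarrow>\<^sub>M count_space UNIV"
    and mono: "\<And>s t r. s \<in> {t0..t1} \<Longrightarrow> t \<in> {t0..t1} \<Longrightarrow> s \<le> t \<Longrightarrow> r \<in> {t0..t1} \<Longrightarrow>
      slope (b s) r \<le> slope (b t) r"
    and init: "\<And>t. t \<in> {t0..t1} \<Longrightarrow> val (b t0) t = 0"
  defines "p \<equiv> \<lambda>t. val (b t) t - integral {t0..t} (\<lambda>s. slope (b s) s)"
  shows "feasible t0 t1 v (\<lambda>t. return_pmf (b t)) p" "val (b t0) t0 - p t0 = 0"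
proof -
  define D where "D = (\<lambda>s. slope (b s) s)"
  \<comment> \<open>Summing over the finitely many bundles, each with its indicator, reduces the
    composition to products of measurable functions.\<close>
  have select: "bounded_measurable_on {t0..t1} (\<lambda>t. g (b t) t)"
    if "\<And>c. continuous_on {t0..t1} (g c)" for g :: "'g set \<Rightarrow> real \<Rightarrow> real"
  proof -
    have "(\<lambda>t. of_bool (b t = c) :: real) \<in> borel_measurable (restrict_space borel {t0..t1})" for c
      using measurable_compose[OF meas, of "\<lambda>x. of_bool (x = c) :: real" borel] by simp
    then have "bounded_measurable_on {t0..t1} (\<lambda>t. \<Sum>c\<in>UNIV. of_bool (b t = c) * g c t)"
      by (intro bounded_measurable_on_sum bounded_measurable_on_mult bounded_measurable_on_continuous that
          bounded_measurable_onI[where C = 1]) auto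
    moreover have "(\<Sum>c\<in>UNIV. of_bool (b t = c) * g c t) = g (b t) t" for t
      by simp
    ultimately show ?thesis
      by simp
  qed
  have D_bm: "bounded_measurable_on {t0..t1} D"
    unfolding D_def by (rule select[OF slope_continuous])
  have D_int: "D integrable_on {s..t}" if "s \<in> {t0..t1}" "t \<in> {t0..t1}" for s t
    by (rule integrable_on_subinterval[OF bounded_measurable_on_integrable_on[OF D_bm]]) (use that in auto)
  have combine: "integral {t0..t} D = integral {t0..s} D + integral {s..t} D"
    if "s \<in> {t0..t1}" "t \<in> {t0..t1}" "s \<le> t" for s t
    using Henstock_Kurzweil_Integration.integral_combine[OF _ _ D_int[OF endpoints(1) that(2)], of s] that
    by simp
  have "continuous_on {t0..t1} (\<lambda>t. integral {t0..t} D)"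
    by (rule indefinite_integral_continuous_1[OF D_int[OF endpoints]])
  then have "bounded_measurable_on {t0..t1} p"
    unfolding p_def D_def[symmetric]
    by (intro bounded_measurable_on_diff select[OF val_continuous] bounded_measurable_on_continuous)
  then have "p \<in> borel_measurable (restrict_space borel {t0..t1})"
    by (simp add: bounded_measurable_on_def)
  moreover have "(\<lambda>t. measure_pmf (return_pmf (b t))) \<in> restrict_space borel {t0..t1} \<rightarrow>\<^sub>M prob_algebra (count_space UNIV)"
    using measurable_compose[OF meas, of "\<lambda>x. measure_pmf (return_pmf x)"]
    by (simp add: space_prob_algebra measure_pmf.prob_space_axioms)
  ultimately have mech: "mechanism t0 t1 (\<lambda>t. return_pmf (b t)) p"
    unfolding mechanism_def by (intro measurable_Pair)
  have IC: "val (b t') t - p t' \<le> val (b t) t - p t" if t: "t \<in> {t0..t1}" and t': "t' \<in> {t0..t1}" for t t'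
  proof (cases "t' \<le> t")
    case True
    have "val (b t') t - val (b t') t' \<le> integral {t'..t} D"
      using integral_slope[OF t' t True] integrable_integral[OF D_int[OF t' t]]
    proof (rule has_integral_le)
      fix r assume "r \<in> {t'..t}"
      with t t' show "slope (b t') r \<le> D r"
        unfolding D_def by (intro mono) auto
    qed
    with combine[OF t' t True] show ?thesis
      by (simp add: p_def D_def)
  next
    case False
    then have le: "t \<le> t'"
      by simp
    have "integral {t..t'} D \<le> val (b t') t' - val (b t') t"
      using integrable_integral[OF D_int[OF t t']] integral_slope[OF t t' le]
    proof (rule has_integral_le)
      fix r assume "r \<in> {t..t'}"
      with t t' show "D r \<le> slope (b t') r"
        unfolding D_def by (intro mono) auto
    qed
    with combine[OF t t' le] show ?thesis
      by (simp add: p_def D_def)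
  qed
  show start: "val (b t0) t0 - p t0 = 0"
    by (simp add: p_def)
  have "0 \<le> val (b t) t - p t" if "t \<in> {t0..t1}" for t
    using IC[OF that endpoints(1)] init[OF that] init[OF endpoints(1)] start by simp
  with mech IC show "feasible t0 t1 v (\<lambda>t. return_pmf (b t)) p"
    by (simp add: feasible_def IC_def IR_def)
qed

end

lemma pmf_of_weights:
  fixes w :: "'b::finite \<Rightarrow> real"
  assumes "\<And>b. 0 \<le> w b" "(\<Sum>b\<in>UNIV. w b) = 1"
  obtains a where "\<And>b. pmf a b = w b"
proof -
  have "(\<integral>\<^sup>+ b. ennreal (w b) \<partial>count_space UNIV) = 1"
    using assms by (simp add: nn_integral_count_space_finite sum_ennreal)
  from that[of "embed_pmf w"] pmf_embed_pmf[OF assms(1) this] show thesis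
    by blast
qed

section \<open>The output is the minimal optimal menu\<close>

locale regular_screening = screening t0 t1 f v
  for t0 t1 :: real and f :: "real \<Rightarrow> real" and v :: "'g::finite set pmf \<Rightarrow> real \<Rightarrow> real" +
  assumes val_empty: "\<forall>t\<in>{t0..t1}. v (return_pmf {}) t = 0"
    and virtual_distinct: "\<forall>b b'. b \<noteq> b' \<longrightarrow> (\<exists>t\<in>{t0..t1}. virtual_value t0 t1 f v (return_pmf b) t
                         \<noteq> virtual_value t0 t1 f v (return_pmf b') t)"
    and virtual_neg: "Max {virtual_value t0 t1 f v (return_pmf b) t0 | b. b \<noteq> {}} < 0"
    and virtual_empty: "0 = virtual_value t0 t1 f v (return_pmf {}) t0"
    and val_monotonic: "\<forall>b b'. monotonic_on {t0..t1} (\<lambda>t. v (return_pmf b) t - v (return_pmf b') t)"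
    and virtual_single_crossing: "\<forall>a a'. single_crossing_on {t0..t1}
             (\<lambda>t. virtual_value t0 t1 f v a t - virtual_value t0 t1 f v a' t)"
begin

text \<open>A contrast is a positive multiple of the difference of two lotteries: its positive and negative parts.\<close>

lemma virtual_contrast_single_crossing:
  assumes "(\<Sum>b\<in>UNIV. c b) = 0"
  shows "single_crossing_on {t0..t1} (\<lambda>t. \<Sum>b\<in>UNIV. c b * virtual b t)"
proof -
  define N where "N = (\<Sum>b\<in>UNIV. max (c b) 0)"
  have parts: "c b = max (c b) 0 - max (- c b) 0" for b
    by (simp add: max_def)
  have "(\<Sum>b\<in>UNIV. c b) = N - (\<Sum>b\<in>UNIV. max (- c b) 0)"
    unfolding N_def sum_subtractf[symmetric] by (rule sum.cong[OF refl parts])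
  then have N': "(\<Sum>b\<in>UNIV. max (- c b) 0) = N"
    using assms by simp
  show ?thesis
  proof (cases "N = 0")
    case True
    then have zero: "max (c b) 0 = 0 \<and> max (- c b) 0 = 0" for b
      using N' sum_nonneg_eq_0_iff[of UNIV "\<lambda>b. max (c b) 0"] sum_nonneg_eq_0_iff[of UNIV "\<lambda>b. max (- c b) 0"]
      by (auto simp: N_def)
    have "c b = 0" for b
      using zero[of b] by (auto simp: max_def split: if_splits)
    then show ?thesis
      by (simp add: single_crossing_on_def monotonic_on_def monotone_on_def)
  next
    case False
    moreover have "0 \<le> N"
      unfolding N_def by (intro sum_nonneg) simp
    ultimately have N: "N > 0"
      by simp
    obtain a where a: "\<And>b. pmf a b = max (c b) 0 / N"
      by (rule pmf_of_weights[of "\<lambda>b. max (c b) 0 / N"])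
         (use N in \<open>auto simp: N_def simp flip: sum_divide_distrib\<close>)
    obtain a' where a': "\<And>b. pmf a' b = max (- c b) 0 / N"
      by (rule pmf_of_weights[of "\<lambda>b. max (- c b) 0 / N"])
         (use N N' in \<open>auto simp flip: sum_divide_distrib\<close>)
    have "pmf a b - pmf a' b = c b / N" for b
      unfolding a a' diff_divide_distrib[symmetric] parts[of b, symmetric] ..
    then have "virtual_value t0 t1 f v a t - virtual_value t0 t1 f v a' t = (\<Sum>b\<in>UNIV. c b / N * virtual b t)" for t
      by (simp add: virtual_value_eq_sum sum_subtractf[symmetric] left_diff_distrib[symmetric])
    then have "virtual_value t0 t1 f v a t - virtual_value t0 t1 f v a' t = (\<Sum>b\<in>UNIV. c b * virtual b t) / N" for t
      by (simp add: sum_divide_distrib)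
    then have "sgn (virtual_value t0 t1 f v a t - virtual_value t0 t1 f v a' t) = sgn (\<Sum>b\<in>UNIV. c b * virtual b t)" for t
      using N by (simp add: sgn_divide)
    with virtual_single_crossing[rule_format, of a a'] show ?thesis
      by (simp only: single_crossing_on_def)
  qed
qed

lemma virtual_neg_t0:
  assumes "b \<noteq> {}"
  shows "virtual b t0 < virtual {} t0"
proof -
  have "virtual b t0 \<le> Max {virtual_value t0 t1 f v (return_pmf b) t0 | b. b \<noteq> {}}"
    using assms by (intro Max_ge) (auto simp: virtual_value_return)
  with virtual_neg virtual_empty show ?thesis
    by (simp add: virtual_value_return)
qed

sublocale sc_family t0 t1 virtual "{}"
proof
  show "\<exists>t\<in>{t0..t1}. virtual b t \<noteq> virtual b' t" if "b \<noteq> b'" for b b'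
    using virtual_distinct that by (simp add: virtual_value_return)
qed (rule t0_less_t1 virtual_neg_t0 virtual_continuous virtual_contrast_single_crossing; assumption)+

text \<open>
  At the highest type virtual values and values agree. A decreasing difference of values that ends
  positive would be positive with nonpositive slope at the lowest type, hence the virtual values
  would be ordered the same way at both ends.
\<close>

lemma slope_mono:
  assumes less: "virtual b' t0 < virtual b t0" "virtual b t1 < virtual b' t1" and r: "r \<in> {t0..t1}"
  shows "slope b r \<le> slope b' r"
proof -
  let ?g = "\<lambda>t. val b' t - val b t"
  have deriv: "(?g has_vector_derivative slope b' t - slope b t) (at t within {t0..t1})" if "t \<in> {t0..t1}" for t
    by (intro has_vector_derivative_diff val_derivative that)
  consider "mono_on {t0..t1} ?g" | "antimono_on {t0..t1} ?g"
    using val_monotonic by (auto simp: monotonic_on_def)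
  then show ?thesis
  proof cases
    case 1
    from has_vector_derivative_nonneg_mono_on[OF this t0_less_t1 r deriv[OF r]] show ?thesis
      by simp
  next
    case 2
    then have "mono_on {t0..t1} (\<lambda>t. - ?g t)"
      by (auto simp: monotone_on_def algebra_simps)
    from has_vector_derivative_nonneg_mono_on[OF this t0_less_t1 endpoints(1)
        has_vector_derivative_minus[OF deriv[OF endpoints(1)]]]
    have "slope b' t0 \<le> slope b t0"
      by simp
    then have "survival t0 / f t0 * slope b' t0 \<le> survival t0 / f t0 * slope b t0"
      using f_pos endpoints(1) by (intro mult_left_mono) (auto simp: survival_t0 less_imp_le)
    moreover have "?g t1 \<le> ?g t0"
      using 2 endpoints t0_less_t1 by (auto simp: monotone_on_def)
    moreover have "0 < ?g t1"
      using less(2) by (simp add: virtual_eq survival_t1)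
    ultimately have False
      using less(1) by (simp add: virtual_eq)
    then show ?thesis ..
  qed
qed

text \<open>Ties are broken towards the front of the list, so earlier entries are strictly worse;
  monotonicity in the type rests on this strictness.\<close>

definition best_index :: "real \<Rightarrow> nat" where
  "best_index t = (LEAST i. i < length output_list \<and> (\<forall>b. virtual b t \<le> virtual (output_list ! i) t))"

definition best :: "real \<Rightarrow> 'g set" where
  "best t = output_list ! best_index t"

lemma best_index:
  assumes "t \<in> {t0..t1}"
  shows "best_index t < length output_list" "virtual b t \<le> virtual (best t) t"
    and "j < best_index t \<Longrightarrow> virtual (output_list ! j) t < virtual (best t) t"
proof -
  obtain b where b: "\<And>b'. virtual b' t \<le> virtual b t"
    using ex_is_arg_min_if_finite[of "UNIV :: 'g set set" "\<lambda>b. - virtual b t"]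
    by (force simp: is_arg_min_def not_less)
  obtain c where c: "c \<in> set output_list" "virtual b t \<le> virtual c t"
    by (rule output_attains_max[OF assms])
  then obtain i where "i < length output_list" "c = output_list ! i"
    by (auto simp: in_set_conv_nth)
  with b c have "i < length output_list \<and> (\<forall>b. virtual b t \<le> virtual (output_list ! i) t)"
    by (meson order_trans)
  note L = LeastI[of "\<lambda>i. i < length output_list \<and> (\<forall>b. virtual b t \<le> virtual (output_list ! i) t)", OF this,
      folded best_index_def]
  then show length: "best_index t < length output_list" and max: "virtual b t \<le> virtual (best t) t" for b
    by (auto simp: best_def)
  show "virtual (output_list ! j) t < virtual (best t) t" if "j < best_index t"
  proof (rule ccontr)
    assume "\<not> ?thesis"
    then have "j < length output_list \<and> (\<forall>b. virtual b t \<le> virtual (output_list ! j) t)"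
      using that length max by (meson order_trans less_trans not_le)
    then show False
      using not_less_Least[OF that[unfolded best_index_def]] by blast
  qed
qed

text \<open>If the choice moved back, the later entry minus the earlier one would go from negative
  at \<open>t0\<close> to positive at \<open>t1\<close> and be positive at \<open>s\<close> by the
  tie-breaking rule. It would then be positive at \<open>t\<close>, against maximality
  there.\<close>

lemma best_index_mono:
  assumes "s \<in> {t0..t1}" "t \<in> {t0..t1}" "s \<le> t"
  shows "best_index s \<le> best_index t"
proof (rule ccontr)
  assume "\<not> ?thesis"
  then have less: "best_index t < best_index s"
    by simp
  let ?g = "\<lambda>r. virtual (best s) r - virtual (best t) r"
  have "0 < ?g t"
  proof (rule single_crossing_on_up[OF contrasts_single_crossing[OF contrasts_diff] assms])
    show "?g t0 < 0" "0 < ?g t1"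
      using ranked_less[OF output_ranked less best_index(1)[OF assms(1)]] by (auto simp: best_def)
    show "0 < ?g s"
      using best_index(3)[OF assms(1) less] by (simp add: best_def[of t])
  qed
  with best_index(2)[OF assms(2), of "best s"] show False
    by simp
qed

text \<open>Monotone real functions are Borel; the floor takes the index back to a discrete
  space.\<close>

lemma best_measurable: "best \<in> restrict_space borel {t0..t1} \<rightarrow>\<^sub>M count_space UNIV"
proof -
  have "(\<lambda>t. real (best_index t)) \<in> borel_measurable (restrict_space borel {t0..t1})"
    by (rule borel_measurable_mono_on_fnc) (auto simp: monotone_on_def intro: best_index_mono)
  then have "(\<lambda>t. \<lfloor>real (best_index t)\<rfloor>) \<in> restrict_space borel {t0..t1} \<rightarrow>\<^sub>M count_space UNIV"
    by measurable
  from measurable_compose[OF this, of "\<lambda>i. output_list ! nat i" "count_space UNIV"] show ?thesis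
    by (simp add: best_def[abs_def])
qed

definition best_price :: "real \<Rightarrow> real" where
  "best_price t = val (best t) t - integral {t0..t} (\<lambda>s. slope (best s) s)"

text \<open>Provides the worthless initial bundle on which participation rests.\<close>

lemma best_t0: "best t0 = {}"
  using best_index(2)[OF endpoints(1), of "{}"] virtual_neg_t0[of "best t0"] by fastforce

lemma best_feasible: "feasible t0 t1 v (\<lambda>t. return_pmf (best t)) best_price"
  and best_start: "val (best t0) t0 - best_price t0 = 0"
proof -
  have mono: "slope (best s) r \<le> slope (best t) r"
    if "s \<in> {t0..t1}" "t \<in> {t0..t1}" "s \<le> t" "r \<in> {t0..t1}" for s t r
  proof (cases "best_index s = best_index t")
    case False
    with best_index_mono[OF that(1-3)] have "best_index s < best_index t"
      by simp
    from ranked_less[OF output_ranked this best_index(1)[OF that(2)]] that(4) show ?thesis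
      unfolding best_def by (rule slope_mono)
  qed (simp add: best_def)
  have init: "val (best t0) t = 0" if "t \<in> {t0..t1}" for t
    using val_empty that by (simp add: best_t0)
  show "feasible t0 t1 v (\<lambda>t. return_pmf (best t)) best_price" "val (best t0) t0 - best_price t0 = 0"
    using monotone_selection_feasible[OF best_measurable mono init]
    unfolding best_price_def[abs_def] by simp_all
qed

section \<open>Comparison of virtual surpluses\<close>

definition surplus :: "(real \<Rightarrow> 'g set pmf) \<Rightarrow> real" where
  "surplus a = integral {t0..t1} (\<lambda>t. f t * virtual_value t0 t1 f v (a t) t)"

lemma surplus_integrand_bounded_measurable:
  assumes "feasible t0 t1 v a p"
  shows "bounded_measurable_on {t0..t1} (\<lambda>t. f t * virtual_value t0 t1 f v (a t) t)"
proof -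
  have "mechanism t0 t1 a p"
    using assms by (simp add: feasible_def)
  from mechanism_bounded_measurable_mix[OF this virtual_continuous] show ?thesis
    unfolding virtual_value_eq_sum
    by (intro bounded_measurable_on_mult bounded_measurable_on_continuous[OF f_continuous])
qed

lemma revenue_le_surplus:
  assumes "feasible t0 t1 v a p"
  shows "revenue t0 t1 f p \<le> surplus a"
  using assms revenue_virtual_surplus(2)[of a p] endpoints(1) by (simp add: feasible_def IR_def surplus_def)

lemma revenue_best: "revenue t0 t1 f best_price = surplus (\<lambda>t. return_pmf (best t))"
  using best_feasible best_start revenue_virtual_surplus(2)[of "\<lambda>t. return_pmf (best t)" best_price]
  by (simp add: feasible_def surplus_def)

lemma virtual_value_le_best:
  assumes "t \<in> {t0..t1}"
  shows "virtual_value t0 t1 f v a t \<le> virtual (best t) t"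
proof -
  have "virtual_value t0 t1 f v a t \<le> (\<Sum>b\<in>UNIV. pmf a b * virtual (best t) t)"
    unfolding virtual_value_eq_sum by (intro sum_mono mult_left_mono best_index(2)[OF assms]) simp
  also have "\<dots> = virtual (best t) t"
    using sum_pmf_eq_1[of UNIV a] by (simp flip: sum_distrib_right)
  finally show ?thesis .
qed

lemma surplus_le_best:
  assumes "feasible t0 t1 v a p"
  shows "surplus a \<le> surplus (\<lambda>t. return_pmf (best t))"
  unfolding surplus_def
proof (rule integral_le)
  show "(\<lambda>t. f t * virtual_value t0 t1 f v (a t) t) integrable_on {t0..t1}"
    "(\<lambda>t. f t * virtual_value t0 t1 f v (return_pmf (best t)) t) integrable_on {t0..t1}"
    by (rule bounded_measurable_on_integrable_on surplus_integrand_bounded_measurable assms best_feasible)+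
  show "f t * virtual_value t0 t1 f v (a t) t \<le> f t * virtual_value t0 t1 f v (return_pmf (best t)) t"
    if "t \<in> {t0..t1}" for t
    using f_pos that virtual_value_le_best[OF that, of "a t"]
    by (intro mult_left_mono) (auto simp: virtual_value_return less_imp_le)
qed

lemma output_optimal_menu: "optimal_menu t0 t1 f v (set output_list)"
  unfolding optimal_menu_def optimal_mechanism_def
proof (intro exI conjI allI impI ballI)
  show "feasible t0 t1 v (\<lambda>t. return_pmf (best t)) best_price"
    by (rule best_feasible)
  show "revenue t0 t1 f p' \<le> revenue t0 t1 f best_price" if "feasible t0 t1 v a' p'" for a' p'
    using revenue_le_surplus[OF that] surplus_le_best[OF that] by (simp add: revenue_best)
  show "return_pmf (best t) \<in> return_pmf ` set output_list" if "t \<in> {t0..t1}" for t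
    using best_index(1)[OF that] by (simp add: best_def)
qed

text \<open>
  A menu without \<open>c\<close> loses virtual surplus on an interval of types around one at which \<open>c\<close> is
  strictly best.
\<close>

lemma output_subset_optimal_menu:
  assumes "optimal_menu t0 t1 f v B"
  shows "set output_list \<subseteq> B"
proof (rule ccontr)
  assume "\<not> set output_list \<subseteq> B"
  then obtain c where c: "c \<in> set output_list" "c \<notin> B"
    by blast
  obtain a p where opt: "optimal_mechanism t0 t1 f v a p" and menu: "\<forall>t\<in>{t0..t1}. a t \<in> return_pmf ` B"
    using assms by (auto simp: optimal_menu_def)
  have feas: "feasible t0 t1 v a p"
    using opt by (simp add: optimal_mechanism_def)
  define loss where "loss = (\<lambda>t. f t * virtual_value t0 t1 f v (return_pmf (best t)) t
      - f t * virtual_value t0 t1 f v (a t) t)"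
  have int: "(\<lambda>t. f t * virtual_value t0 t1 f v (a t) t) integrable_on {t0..t1}"
    "(\<lambda>t. f t * virtual_value t0 t1 f v (return_pmf (best t)) t) integrable_on {t0..t1}"
    by (rule bounded_measurable_on_integrable_on surplus_integrand_bounded_measurable feas best_feasible)+
  have loss_int: "loss integrable_on {t0..t1}"
    unfolding loss_def by (intro integrable_diff int)
  have loss_nonneg: "0 \<le> loss t" if "t \<in> {t0..t1}" for t
    using f_pos that virtual_value_le_best[OF that, of "a t"]
    by (auto simp: loss_def virtual_value_return less_imp_le intro!: mult_left_mono)
  \<comment> \<open>The selection earns all of its surplus and \<open>p\<close> at most that of
    \<open>a\<close>, so optimality of \<open>p\<close> leaves no room for a positive total
    loss.\<close>
  have "revenue t0 t1 f best_price \<le> revenue t0 t1 f p"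
    using opt best_feasible by (auto simp: optimal_mechanism_def)
  then have "integral {t0..t1} loss \<le> 0"
    using revenue_le_surplus[OF feas] unfolding revenue_best
    by (simp add: loss_def surplus_def Henstock_Kurzweil_Integration.integral_diff[OF int(2,1)])
  obtain \<tau> where \<tau>: "\<tau> \<in> {t0..t1}" "\<And>b. b \<noteq> c \<Longrightarrow> virtual b \<tau> < virtual c \<tau>"
    using output_strictly_best_somewhere[OF c(1)] by blast
  obtain m where m: "m > 0" "\<And>t. t \<in> {t0..t1} \<Longrightarrow> m \<le> f t"
  proof -
    obtain x where "x \<in> {t0..t1}" "\<forall>t\<in>{t0..t1}. f x \<le> f t"
      using continuous_attains_inf[OF compact_Icc _ f_continuous] endpoints by blast
    with f_pos that[of "f x"] show thesis by blast
  qed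
  \<comment> \<open>Half the smallest lead of \<open>c\<close> at \<open>\<tau>\<close>: halving
    makes the bound strict, so that it persists nearby. The inserted 1 keeps the argument of
    \<open>Min\<close> visibly nonempty.\<close>
  define \<eta> where "\<eta> = Min (insert 1 ((\<lambda>b. virtual c \<tau> - virtual b \<tau>) ` (- {c}))) / 2"
  have "\<eta> > 0"
    using \<tau>(2) by (simp add: \<eta>_def)
  have gap: "\<eta> < virtual c \<tau> - virtual b \<tau>" if "b \<noteq> c" for b
  proof -
    have "Min (insert 1 ((\<lambda>b. virtual c \<tau> - virtual b \<tau>) ` (- {c}))) \<le> virtual c \<tau> - virtual b \<tau>"
      using that by (intro Min_le) auto
    with \<tau>(2)[OF that] show ?thesis
      by (simp add: \<eta>_def)
  qed
  have "\<forall>\<^sub>F t in at \<tau> within {t0..t1}. \<forall>b\<in>- {c}. \<eta> < virtual c t - virtual b t"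
  proof (intro eventually_ball_finite finite ballI)
    fix b assume "b \<in> - {c}"
    have "continuous_on {t0..t1} (\<lambda>t. virtual c t - virtual b t)"
      by (intro continuous_intros virtual_continuous)
    then have "((\<lambda>t. virtual c t - virtual b t) \<longlongrightarrow> virtual c \<tau> - virtual b \<tau>) (at \<tau> within {t0..t1})"
      using \<tau>(1) by (simp add: continuous_on_def)
    then show "\<forall>\<^sub>F t in at \<tau> within {t0..t1}. \<eta> < virtual c t - virtual b t"
      by (rule order_tendstoD(1)) (use gap \<open>b \<in> - {c}\<close> in simp)
  qed
  then obtain d where d: "d > 0" "\<And>t b. t \<in> {t0..t1} \<Longrightarrow> t \<noteq> \<tau> \<Longrightarrow> dist t \<tau> < d \<Longrightarrow> b \<noteq> c \<Longrightarrow>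
      \<eta> < virtual c t - virtual b t"
    unfolding eventually_at by blast
  \<comment> \<open>Half the radius keeps the closed interval inside the open ball; the truncation
    allows \<open>\<tau>\<close> to be an extreme type.\<close>
  define lo hi where "lo = max t0 (\<tau> - d / 2)" and "hi = min t1 (\<tau> + d / 2)"
  have lohi: "lo < hi" "{lo..hi} \<subseteq> {t0..t1}"
    using \<tau>(1) d(1) t0_less_t1 by (auto simp: lo_def hi_def)
  have loss_int': "loss integrable_on {lo..hi}"
    by (rule integrable_on_subinterval[OF loss_int lohi(2)])
  have "m * \<eta> \<le> loss t" if t: "t \<in> {lo..hi}" for t
  proof -
    have tT: "t \<in> {t0..t1}"
      using t lohi(2) by blast
    then obtain b where b: "a t = return_pmf b" "b \<noteq> c"
      using menu c(2) by blast
    have "dist t \<tau> < d"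
      using t d(1) by (auto simp: lo_def hi_def dist_real_def)
    then have "\<eta> < virtual c t - virtual b t"
      using d(2)[OF tT _ _ b(2)] gap[OF b(2)] by (cases "t = \<tau>") auto
    then have "\<eta> \<le> virtual (best t) t - virtual b t"
      using best_index(2)[OF tT, of c] by simp
    then have "m * \<eta> \<le> f t * (virtual (best t) t - virtual b t)"
      using m(2)[OF tT] m(1) \<open>\<eta> > 0\<close> by (intro mult_mono) auto
    then show ?thesis
      by (simp add: loss_def b(1) virtual_value_return right_diff_distrib)
  qed
  then have "integral {lo..hi} (\<lambda>_. m * \<eta>) \<le> integral {lo..hi} loss"
    by (intro integral_le loss_int') auto
  also have "\<dots> \<le> integral {t0..t1} loss"
    by (rule integral_subset_le[OF lohi(2) loss_int' loss_int]) (use loss_nonneg in auto)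
  finally have "(hi - lo) * (m * \<eta>) \<le> 0"
    using \<open>integral {t0..t1} loss \<le> 0\<close> lohi(1) by (simp add: mult.left_commute)
  then show False
    using lohi(1) m(1) \<open>\<eta> > 0\<close> by (simp add: mult_le_0_iff)
qed

text \<open>The output is optimal and contained in every optimal menu. A least optimal menu is the
  only minimal one.\<close>

lemma output_minimal_optimal_menu:
  "minimal_optimal_menu t0 t1 f v B \<longleftrightarrow> B = set output_list"
  unfolding minimal_optimal_menu_def
  using output_optimal_menu output_subset_optimal_menu by blast

end

theorem theorem2:
  fixes t0 t1 :: real
    and f :: "real \<Rightarrow> real"
    and v :: "'g::finite set pmf \<Rightarrow> real \<Rightarrow> real"
  assumes "t0 < t1"
    and "continuous_on {t0..t1} f"
    and "\<forall>t\<in>{t0..t1}. f t > 0"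
    and "prob_space (type_distr t0 t1 f)"
    and "\<forall>a. continuously_differentiable_on {t0..t1} (v a)"
    and "\<forall>t\<in>{t0..t1}. v (return_pmf {}) t = 0"
    and "\<forall>a. \<forall>t\<in>{t0..t1}. v a t = measure_pmf.expectation a (\<lambda>b. v (return_pmf b) t)"
    and "\<forall>b b'. b \<noteq> b' \<longrightarrow>
           (\<exists>t\<in>{t0..t1}. virtual_value t0 t1 f v (return_pmf b) t
                         \<noteq> virtual_value t0 t1 f v (return_pmf b') t)"
    and "Max {virtual_value t0 t1 f v (return_pmf b) t0 | b. b \<noteq> {}} < 0"
    and "0 = virtual_value t0 t1 f v (return_pmf {}) t0"
    and A1: "\<forall>b b'.
           single_crossing_on {t0..t1}
             (\<lambda>t. virtual_value t0 t1 f v (return_pmf b) t - virtual_value t0 t1 f v (return_pmf b') t) \<and>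
           monotonic_on {t0..t1} (\<lambda>t. v (return_pmf b) t - v (return_pmf b') t)"
    and A2: "\<forall>a a'.
           single_crossing_on {t0..t1}
             (\<lambda>t. virtual_value t0 t1 f v a t - virtual_value t0 t1 f v a' t)"
  shows "let B = elimination_output
                   (\<lambda>b. virtual_value t0 t1 f v (return_pmf b) t0)
                   (\<lambda>b. virtual_value t0 t1 f v (return_pmf b) t1) UNIV
         in minimal_optimal_menu t0 t1 f v B \<and>
            (\<forall>B'. minimal_optimal_menu t0 t1 f v B' \<longrightarrow> B' = B)"
proof -
  have A1': "\<forall>b b'. monotonic_on {t0..t1} (\<lambda>t. v (return_pmf b) t - v (return_pmf b') t)"
    using A1 by blast
  interpret regular_screening t0 t1 f v
    by (intro regular_screening.intro screening.intro regular_screening_axioms.intro assms A1')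
  show ?thesis
    unfolding Let_def virtual_value_return set_output_list[symmetric]
    using output_minimal_optimal_menu by blast
qed

end
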